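(* Let $F$ be a field, let $L$ be a simple Lie algebra over $F$, let $\rho:L\to \mathrm{End}_F(W)$ be any non-trivial finite-dimensional irreducible representation of $L$, let $V=\rho(L)\subseteq\mathrm{End}_F(W)$, and let $R$ be the associative subalgebra of $\mathrm{End}_F(W)$ generated by $V$. Then the pair $(R,V)$ has a weak central polynomial.
   Context: Polynomials are elements of the free associative algebra $F\langle x_1,x_2,\ldots\rangle$. A polynomial $f(x_1,\ldots,x_n)$ is an identity for the pair $(R,V)$ if $f(v_1,\ldots,v_n)=0$ for all $v_i\in V$. A polynomial $c(x_1,\ldots,x_n)$ is a (weak, non-trivial) central polynomial for the pair $(R,V)$ if $c(v_1,\ldots,v_n)$ belongs to the center of $R$ for all $v_1,\ldots,v_n\in V$ and $c$ is not an identity for $(R,V)$. Central polynomials here are understood to be non-constant. A representation is non-trivial if $\rho(L)\neq 0$. *)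

theory Defs
  imports Complex_Main "HOL-Library.Poly_Mapping"
begin

section \<open>Lie algebras and their representations\<close>

locale lie_algebra = vector_space scale
  for scale :: "'f::field \<Rightarrow> 'l::ab_group_add \<Rightarrow> 'l" +
  fixes bracket :: "'l \<Rightarrow> 'l \<Rightarrow> 'l"
  assumes bracket_add_left: "bracket (x + y) z = bracket x z + bracket y z"
    and bracket_add_right: "bracket x (y + z) = bracket x y + bracket x z"
    and bracket_scale_left: "bracket (scale a x) y = scale a (bracket x y)"
    and bracket_scale_right: "bracket x (scale a y) = scale a (bracket x y)"
    and bracket_self: "bracket x x = 0"
    and jacobi: "bracket x (bracket y z) + bracket y (bracket z x) + bracket z (bracket x y) = 0"
begin

definition lie_ideal :: "'l set \<Rightarrow> bool" where
  "lie_ideal I \<longleftrightarrow> subspace I \<and> (\<forall>x. \<forall>y\<in>I. bracket x y \<in> I)"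

end

locale simple_lie_algebra = lie_algebra +
  assumes nonabelian: "\<exists>x y. bracket x y \<noteq> 0"
    and ideal_trivial: "lie_ideal I \<Longrightarrow> I = {0} \<or> I = UNIV"

locale lie_representation =
  L: lie_algebra scaleL bracket + W: vector_space scaleW
  for scaleL :: "'f::field \<Rightarrow> 'l::ab_group_add \<Rightarrow> 'l"
    and bracket :: "'l \<Rightarrow> 'l \<Rightarrow> 'l"
    and scaleW :: "'f \<Rightarrow> 'w::ab_group_add \<Rightarrow> 'w" +
  fixes rho :: "'l \<Rightarrow> 'w \<Rightarrow> 'w"
  assumes rho_endo: "Vector_Spaces.linear scaleW scaleW (rho x)"
    and rho_add: "rho (x + y) = (\<lambda>w. rho x w + rho y w)"
    and rho_scale: "rho (scaleL a x) = (\<lambda>w. scaleW a (rho x w))"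
    and rho_bracket: "rho (bracket x y) = (\<lambda>w. rho x (rho y w) - rho y (rho x w))"

locale irreducible_lie_representation = lie_representation scaleL bracket scaleW rho
  for scaleL :: "'f::field \<Rightarrow> 'l::ab_group_add \<Rightarrow> 'l"
    and bracket :: "'l \<Rightarrow> 'l \<Rightarrow> 'l"
    and scaleW :: "'f \<Rightarrow> 'w::ab_group_add \<Rightarrow> 'w"
    and rho :: "'l \<Rightarrow> 'w \<Rightarrow> 'w" +
  assumes nonzero_space: "\<exists>w::'w. w \<noteq> 0"
    and invariant_trivial:
      "W.subspace U \<Longrightarrow> (\<And>x u. u \<in> U \<Longrightarrow> rho x u \<in> U) \<Longrightarrow> U = {0} \<or> U = UNIV"


section \<open>The free associative algebra\<close>

text \<open>
  Words in the letters \<open>x\<^sub>0, x\<^sub>1, \<dots>\<close> under concatenation. The wrapper around lists avoids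
  a monoid structure on the type of lists itself.
\<close>

datatype nc_word = Word (letters: "nat list")

instantiation nc_word :: monoid_add
begin

definition zero_nc_word :: nc_word where
  "0 = Word []"

definition plus_nc_word :: "nc_word \<Rightarrow> nc_word \<Rightarrow> nc_word" where
  "u + v = Word (letters u @ letters v)"

instance
  by standard (simp_all add: zero_nc_word_def plus_nc_word_def)

end

text \<open>
  The monoid algebra of words is the free unital associative algebra
  \<open>F\<langle>x\<^sub>0, x\<^sub>1, \<dots>\<rangle>\<close>; its ring structure is the convolution of \<^type>\<open>poly_mapping\<close>.
\<close>

type_synonym 'f nc_poly = "nc_word \<Rightarrow>\<^sub>0 'f"

text \<open>
  Substitution of the operators \<open>v 0, v 1, \<dots>\<close> for the variables. The word
  \<open>x\<^sub>i x\<^sub>j \<dots>\<close> becomes the composition \<open>v i \<circ> v j \<circ> \<dots>\<close>, the empty word the identity.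
\<close>

definition word_eval :: "(nat \<Rightarrow> 'w \<Rightarrow> 'w) \<Rightarrow> nc_word \<Rightarrow> 'w \<Rightarrow> 'w" where
  "word_eval v u = foldr (\<lambda>i g. v i \<circ> g) (letters u) id"

definition nc_eval ::
  "('f::field \<Rightarrow> 'w::ab_group_add \<Rightarrow> 'w) \<Rightarrow> 'f nc_poly \<Rightarrow> (nat \<Rightarrow> 'w \<Rightarrow> 'w) \<Rightarrow> 'w \<Rightarrow> 'w" where
  "nc_eval scale c v =
    (\<lambda>w. \<Sum>u\<in>Poly_Mapping.keys c. scale (Poly_Mapping.lookup c u) (word_eval v u w))"


section \<open>Subalgebras of the endomorphism algebra\<close>

definition End_subalgebra ::
  "('f::field \<Rightarrow> 'w::ab_group_add \<Rightarrow> 'w) \<Rightarrow> ('w \<Rightarrow> 'w) set \<Rightarrow> bool" where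
  "End_subalgebra scale R \<longleftrightarrow>
    (\<forall>f\<in>R. Vector_Spaces.linear scale scale f) \<and>
    id \<in> R \<and>
    (\<forall>f\<in>R. \<forall>g\<in>R. (\<lambda>w. f w + g w) \<in> R) \<and>
    (\<forall>a. \<forall>f\<in>R. (\<lambda>w. scale a (f w)) \<in> R) \<and>
    (\<forall>f\<in>R. \<forall>g\<in>R. f \<circ> g \<in> R)"

text \<open>
  Subalgebras contain the identity, so that they contain the values of polynomials with a
  constant term. For the algebra generated by the image of a non-trivial finite-dimensional
  irreducible representation this is no restriction: the non-unital subalgebra generated by
  the image is simple and acts irreducibly, so it contains the identity.
\<close>

definition generated_subalgebra ::
  "('f::field \<Rightarrow> 'w::ab_group_add \<Rightarrow> 'w) \<Rightarrow> ('w \<Rightarrow> 'w) set \<Rightarrow> ('w \<Rightarrow> 'w) set" where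
  "generated_subalgebra scale V = End_subalgebra scale hull V"

definition center :: "('w \<Rightarrow> 'w) set \<Rightarrow> ('w \<Rightarrow> 'w) set" where
  "center R = {z \<in> R. \<forall>r\<in>R. z \<circ> r = r \<circ> z}"


section \<open>Identities and central polynomials of a pair\<close>

text \<open>
  For a pair \<open>(R, V)\<close> with \<open>V \<subseteq> R\<close>, whether a polynomial is an identity depends on \<open>V\<close> only.
  A polynomial involves finitely many variables, so ranging over all sequences in \<open>V\<close> amounts
  to ranging over all tuples.
\<close>

definition identity_on ::
  "('f::field \<Rightarrow> 'w::ab_group_add \<Rightarrow> 'w) \<Rightarrow> ('w \<Rightarrow> 'w) set \<Rightarrow> 'f nc_poly \<Rightarrow> bool" where
  "identity_on scale V c \<longleftrightarrow> (\<forall>v. range v \<subseteq> V \<longrightarrow> nc_eval scale c v = (\<lambda>w. 0))"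

text \<open>
  Central polynomials have to be non-constant. This must refer to the values on \<open>V\<close>: requiring
  only that \<open>c\<close> is not a scalar of the free algebra would admit \<open>1 + f\<close> for every identity
  \<open>f \<noteq> 0\<close>, and such \<open>f\<close> always exist in finite dimension.
\<close>

definition nonconstant_on ::
  "('f::field \<Rightarrow> 'w::ab_group_add \<Rightarrow> 'w) \<Rightarrow> ('w \<Rightarrow> 'w) set \<Rightarrow> 'f nc_poly \<Rightarrow> bool" where
  "nonconstant_on scale V c \<longleftrightarrow>
    (\<exists>v v'. range v \<subseteq> V \<and> range v' \<subseteq> V \<and> nc_eval scale c v \<noteq> nc_eval scale c v')"

definition weak_central_polynomial ::
  "('f::field \<Rightarrow> 'w::ab_group_add \<Rightarrow> 'w) \<Rightarrow> ('w \<Rightarrow> 'w) set \<Rightarrow> ('w \<Rightarrow> 'w) set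
    \<Rightarrow> 'f nc_poly \<Rightarrow> bool" where
  "weak_central_polynomial scale R V c \<longleftrightarrow>
    (\<forall>v. range v \<subseteq> V \<longrightarrow> nc_eval scale c v \<in> center R) \<and>
    \<not> identity_on scale V c \<and>
    nonconstant_on scale V c"

end

theory Submission
  imports Defs "HOL-Library.Countable_Set"
begin

text \<open>
  Irreducibility makes \<open>R\<close> a simple ring that is finite-dimensional over its centre \<open>K\<close>, and the
  theorem follows from the existence of a central polynomial for \<open>R\<close> into which polynomials
  in elements of \<open>V\<close> are substituted; the Lie bracket plays no role.

  To the operator \<open>x \<mapsto> \<Sum>i. a\<^sub>i x b\<^sub>i\<close> on \<open>R\<close> associate its flip
  \<open>x \<mapsto> \<Sum>i. b\<^sub>i x a\<^sub>i\<close>. An operator takes central values iff its flip annihilates all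
  commutators. The linear operator that sends one element of a \<open>K\<close>-basis to \<open>1\<close> and the others
  to \<open>0\<close> is of this form, and flipping it shows \<open>[R, R] \<noteq> R\<close>. Now take a maximal
  \<open>K\<close>-independent family of commutators and an operator, polynomial in them and in auxiliary
  variables, that annihilates their span without being zero. Under any other substitution the
  commutators either still span \<open>[R, R]\<close> or become dependent, in which case the operator
  vanishes. So it always annihilates \<open>[R, R]\<close>, and its flip always takes central values.
\<close>

section \<open>Two-sided multiplication operators\<close>

fun sandwich :: "('a::ring \<times> 'a) list \<Rightarrow> 'a \<Rightarrow> 'a" where
  "sandwich [] x = 0"
| "sandwich ((a, b) # ps) x = a * x * b + sandwich ps x"

abbreviation flip :: "('a \<times> 'a) list \<Rightarrow> ('a \<times> 'a) list" where
  "flip \<equiv> map prod.swap"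

lemma sandwich_append: "sandwich (ps @ qs) x = sandwich ps x + sandwich qs x"
  by (induction ps) auto

lemma sandwich_add: "sandwich ps (x + y) = sandwich ps x + sandwich ps y"
  by (induction ps) (auto simp: algebra_simps)

lemma sandwich_diff: "sandwich ps (x - y) = sandwich ps x - sandwich ps y"
  by (induction ps) (auto simp: algebra_simps)

lemma sandwich_zero [simp]: "sandwich ps 0 = 0"
  by (induction ps) auto

lemma sandwich_map_outer:
  "sandwich (map (\<lambda>(a, b). (p * a, b * q)) ps) x = p * sandwich ps x * q"
  by (induction ps) (auto simp: algebra_simps)

text \<open>Applying \<open>qs\<close> to all right factors preserves relations: if
  \<open>sandwich ps\<close> vanishes on a ring containing \<open>y\<close> and the entries of
  \<open>qs\<close>, every summand on the right is zero. Together with simplicity this normalises a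
  right factor to 1.\<close>

lemma sandwich_compose_right:
  "sandwich (map (\<lambda>(a, b). (a, sandwich qs b)) ps) y =
    sum_list (map (\<lambda>(p, q). sandwich ps (y * p) * q) qs)"
proof (induction ps)
  case Nil
  then show ?case by (induction qs) auto
next
  case (Cons p ps)
  have "a * y * sandwich qs b = sum_list (map (\<lambda>(p, q). a * (y * p) * b * q) qs)" for a b
    by (induction qs) (auto simp: algebra_simps)
  with Cons show ?case
    by (cases p) (simp add: case_prod_unfold sum_list_addf algebra_simps)
qed

lemma sum_list_all_zero: "(\<And>x. x \<in> set xs \<Longrightarrow> f x = 0) \<Longrightarrow> sum_list (map f xs) = 0"
  by (induction xs) auto

text \<open>\<open>K\<close> is a subset of the ring and not a type of scalars, so span and
  independence are defined along lists. The inductions below split off the coefficient of the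
  head.\<close>

primrec kspan :: "'a::ring set \<Rightarrow> 'a list \<Rightarrow> 'a set" where
  "kspan K [] = {0}"
| "kspan K (x # xs) = {k * x + s |k s. k \<in> K \<and> s \<in> kspan K xs}"

primrec kindep :: "'a::ring set \<Rightarrow> 'a list \<Rightarrow> bool" where
  "kindep K [] \<longleftrightarrow> True"
| "kindep K (x # xs) \<longleftrightarrow> x \<notin> kspan K xs \<and> kindep K xs"

text \<open>
  Operators in \<open>elim_ops S us\<close> annihilate \<open>us\<close>. They play the role of Capelli polynomials: the
  next one is \<open>x \<mapsto> L x * y * L' u - L u * y * L' x\<close>, and the freedom to choose \<open>L\<close> and
  \<open>L'\<close> independently keeps the common kernel as small as possible.
\<close>

definition elim_step :: "('a::ring \<times> 'a) list \<Rightarrow> ('a \<times> 'a) list \<Rightarrow> 'a \<Rightarrow> 'a \<Rightarrow> ('a \<times> 'a) list" where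
  "elim_step L L' u y =
    map (\<lambda>(a, b). (a, b * (y * sandwich L' u))) L @
    map (\<lambda>(a, b). (- (sandwich L u * y * a), b)) L'"

inductive elim_ops :: "'a::{ring,monoid_mult} set \<Rightarrow> 'a list \<Rightarrow> ('a \<times> 'a) list \<Rightarrow> bool"
  for S where
  Nil: "elim_ops S [] [(1, 1)]"
| Cons: "elim_ops S us L \<Longrightarrow> elim_ops S us L' \<Longrightarrow> y \<in> S \<Longrightarrow> u \<in> S \<Longrightarrow>
    elim_ops S (u # us) (elim_step L L' u y)"

lemma sandwich_elim_step:
  fixes x :: "'a::{ring,monoid_mult}"
  shows "sandwich (elim_step L L' u y) x =
    sandwich L x * y * sandwich L' u - sandwich L u * y * sandwich L' x"
proof -
  have "sandwich (map (\<lambda>(a, b). (a, b * (y * sandwich L' u))) L) x =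
      sandwich L x * y * sandwich L' u"
    using sandwich_map_outer[of 1 _ L x] by (simp add: mult.assoc)
  moreover have "sandwich (map (\<lambda>(a, b). (- (sandwich L u * y * a), b)) L') x =
      - (sandwich L u * y * sandwich L' x)"
    using sandwich_map_outer[of "- (sandwich L u * y)" 1 L' x] by (simp add: mult.assoc)
  ultimately show ?thesis
    by (simp add: elim_step_def sandwich_append)
qed

text \<open>Single commutators only; their span enters through \<open>kspan\<close> of lists of
  commutators.\<close>

definition commutators :: "'a::ring set \<Rightarrow> 'a set" where
  "commutators S = {r * s - s * r |r s. r \<in> S \<and> s \<in> S}"

lemma commutators_mono: "S \<subseteq> T \<Longrightarrow> commutators S \<subseteq> commutators T"
  by (auto simp: commutators_def)


section \<open>Simple rings that are finite-dimensional over their centre\<close>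

text \<open>
  The bound on independent lists is the only form in which finite dimension over the centre
  \<open>K\<close> enters.
\<close>

locale simple_subring =
  fixes R K :: "'a::{ring,monoid_mult} set"
  assumes one_neq_zero: "(1::'a) \<noteq> 0"
    and one_closed [simp]: "1 \<in> R"
    and add_closed [simp]: "x \<in> R \<Longrightarrow> y \<in> R \<Longrightarrow> x + y \<in> R"
    and uminus_closed [simp]: "x \<in> R \<Longrightarrow> - x \<in> R"
    and mult_closed [simp]: "x \<in> R \<Longrightarrow> y \<in> R \<Longrightarrow> x * y \<in> R"
    and simple: "b \<in> R \<Longrightarrow> b \<noteq> 0 \<Longrightarrow> \<exists>ps. set ps \<subseteq> R \<times> R \<and> sandwich ps b = 1"
    and K_def: "K = {k \<in> R. \<forall>r\<in>R. k * r = r * k}"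
    and bounded_indep: "\<exists>N. \<forall>xs. set xs \<subseteq> R \<longrightarrow> kindep K xs \<longrightarrow> length xs \<le> N"
begin

lemma diff_closed [simp]: "x \<in> R \<Longrightarrow> y \<in> R \<Longrightarrow> x - y \<in> R"
  using add_closed[of x "- y"] by simp

lemma zero_closed [simp]: "0 \<in> R"
  using diff_closed[of 1 1] by simp

lemma K_I: "k \<in> R \<Longrightarrow> (\<And>r. r \<in> R \<Longrightarrow> k * r = r * k) \<Longrightarrow> k \<in> K"
  by (simp add: K_def)

lemma K_sub: "k \<in> K \<Longrightarrow> k \<in> R"
  by (simp add: K_def)

lemma K_commute: "k \<in> K \<Longrightarrow> r \<in> R \<Longrightarrow> r * k = k * r"
  by (simp add: K_def)

lemma K_one [simp]: "1 \<in> K"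
  by (simp add: K_def)

lemma K_uminus: "k \<in> K \<Longrightarrow> - k \<in> K"
  by (rule K_I) (simp_all add: K_sub K_commute[of k])

lemma sandwich_closed [simp]: "set ps \<subseteq> R \<times> R \<Longrightarrow> x \<in> R \<Longrightarrow> sandwich ps x \<in> R"
  by (induction ps) auto

lemma flip_closed: "set ps \<subseteq> R \<times> R \<Longrightarrow> set (flip ps) \<subseteq> R \<times> R"
  by auto

lemma sandwich_K:
  "set ps \<subseteq> R \<times> R \<Longrightarrow> x \<in> R \<Longrightarrow> k \<in> K \<Longrightarrow> sandwich ps (k * x) = k * sandwich ps x"
proof (induction ps)
  case (Cons p ps)
  obtain a b where p: "p = (a, b)" by (cases p)
  with Cons have "a * k = k * a" by (intro K_commute) auto
  then have "a * (k * x) * b = k * (a * x * b)" by (simp flip: mult.assoc)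
  with Cons p show ?case by (auto simp: algebra_simps)
qed simp

lemma kspan_ConsI: "k \<in> K \<Longrightarrow> s \<in> kspan K xs \<Longrightarrow> k * x + s \<in> kspan K (x # xs)"
  by auto

lemma sandwich_kspan:
  assumes "set ps \<subseteq> R \<times> R" "set us \<subseteq> R" "\<And>u. u \<in> set us \<Longrightarrow> sandwich ps u = 0"
    "x \<in> kspan K us"
  shows "sandwich ps x = 0"
  using assms(2-)
proof (induction us arbitrary: x)
  case (Cons u us)
  then obtain k s where "x = k * u + s" "k \<in> K" "s \<in> kspan K us" by auto
  with Cons show ?case by (auto simp: sandwich_add sandwich_K[OF assms(1)])
qed simp

section \<open>Relations with independent left factors\<close>

lemma kspan_head_elimination:
  assumes "set ((a, 1) # ps) \<subseteq> R \<times> K" "a \<in> R" "sandwich ((a, 1) # ps) 1 = 0"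
  shows "a \<in> kspan K (map fst ps)"
proof -
  have "- sandwich qs 1 \<in> kspan K (map fst qs)" if "set qs \<subseteq> R \<times> K" for qs
    using that
  proof (induction qs)
    case (Cons q qs)
    obtain x k where q: "q = (x, k)" by (cases q)
    with Cons.prems have "x * k = k * x" "- k \<in> K" by (auto simp: K_commute K_uminus)
    moreover from this have "- sandwich (q # qs) 1 = - k * x + - sandwich qs 1"
      by (simp add: q)
    ultimately show ?case using Cons q kspan_ConsI[of "- k" "- sandwich qs 1"] by simp
  qed simp
  moreover have "a = - sandwich ps 1"
    using assms(3) by (simp add: eq_neg_iff_add_eq_0)
  ultimately show ?thesis using assms(1) by auto
qed

text \<open>If the head coefficient is nonzero, simplicity turns it into 1. Comparing the relation
  at \<open>y * z\<close> with \<open>z\<close> times the relation at \<open>y\<close> then removes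
  the head, so by induction the other coefficients commute with every \<open>z\<close>. They are
  therefore central, and \<open>y = 1\<close> exhibits the head as a combination of the other left
  factors.\<close>

lemma indep_coefficients_zero:
  assumes "set ps \<subseteq> R \<times> R" "kindep K (map fst ps)" "\<And>y. y \<in> R \<Longrightarrow> sandwich ps y = 0"
  shows "\<forall>p\<in>set ps. snd p = 0"
  using assms
proof (induction "map fst ps" arbitrary: ps)
  case (Cons a as)
  then obtain b ps' where ps: "ps = (a, b) # ps'" and as: "as = map fst ps'"
    by (cases ps) auto
  have in_R: "a \<in> R" "b \<in> R" "set ps' \<subseteq> R \<times> R" using Cons.prems ps by auto
  have IH: "\<forall>q\<in>set qs. snd q = 0"
    if "set qs \<subseteq> R \<times> R" "map fst qs = as" "\<And>y. y \<in> R \<Longrightarrow> sandwich qs y = 0" for qs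
    using Cons.hyps(1)[of qs] that Cons.prems(2) ps as by simp
  have "b = 0"
  proof (rule ccontr)
    assume "b \<noteq> 0"
    then obtain ts where ts: "set ts \<subseteq> R \<times> R" "sandwich ts b = 1" using simple in_R by blast
    \<comment> \<open>The tail of the relation after \<open>ts\<close> has turned the head
      coefficient \<open>b\<close> into 1.\<close>
    define cs where "cs = map (\<lambda>(a, b). (a, sandwich ts b)) ps'"
    have cs_R: "set cs \<subseteq> R \<times> R" using in_R(3) ts(1) by (force simp: cs_def)
    have fst_cs: "map fst cs = as" by (auto simp: cs_def as)
    have "sandwich ((a, 1) # cs) y = 0" if y: "y \<in> R" for y
    proof -
      have "sandwich ps (y * fst t) = 0" if "t \<in> set ts" for t
        using that ts(1) y by (intro Cons.prems(3)) auto
      then have "sandwich (map (\<lambda>(a, b). (a, sandwich ts b)) ps) y = 0"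
        unfolding sandwich_compose_right by (intro sum_list_all_zero) auto
      then show ?thesis using ts(2) by (simp add: ps cs_def)
    qed
    then have eq0: "sandwich cs y = - (a * y)" if "y \<in> R" for y
      using that by (simp add: eq_neg_iff_add_eq_0 add.commute)
    have "z * snd c = snd c * z" if c: "c \<in> set cs" and z: "z \<in> R" for c z
    proof -
      \<comment> \<open>The head contributes \<open>a * (y * z) - (a * y) * z = 0\<close>, so
        \<open>ds\<close> is a relation between the left factors \<open>as\<close> alone.\<close>
      define ds where "ds = map (\<lambda>(a, b). (a, z * b - b * z)) cs"
      have "sandwich ds y = sandwich cs (y * z) - sandwich cs y * z" for y
        unfolding ds_def by (induction cs) (auto simp: algebra_simps)
      then have "sandwich ds y = 0" if "y \<in> R" for y
        using that z by (simp add: eq0 mult.assoc)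
      moreover have "set ds \<subseteq> R \<times> R" using cs_R z by (auto simp: ds_def)
      moreover have "map fst ds = as" using fst_cs by (auto simp: ds_def)
      ultimately have "\<forall>d\<in>set ds. snd d = 0" using IH by blast
      then have "z * snd c - snd c * z = 0" using c by (auto simp: ds_def case_prod_unfold)
      then show ?thesis by simp
    qed
    with cs_R have "set cs \<subseteq> R \<times> K" by (fastforce intro!: K_I)
    then have "a \<in> kspan K (map fst cs)"
      using eq0[of 1] in_R by (intro kspan_head_elimination) auto
    with Cons.prems(2) fst_cs ps as show False by simp
  qed
  moreover have "\<forall>p\<in>set ps'. snd p = 0"
    using IH[of ps'] in_R(3) Cons.prems(3) as ps \<open>b = 0\<close> by simp
  ultimately show ?case using ps by simp
qed simp

text \<open>Primeness of \<open>R\<close>, read off from a relation with one summand.\<close>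

lemma mult_mult_zero:
  assumes "a \<in> R" "q \<in> R" "q \<noteq> 0" "\<And>y. y \<in> R \<Longrightarrow> a * y * q = 0"
  shows "a = 0"
proof -
  have "a \<notin> kspan K [] \<Longrightarrow> q = 0"
    using indep_coefficients_zero[of "[(a, q)]"] assms by simp
  with assms(3) show ?thesis by auto
qed

text \<open>Otherwise \<open>p\<close> and \<open>q\<close> are independent left factors of the
  vanishing operator \<open>p * y * r - q * y * s\<close>, which forces
  \<open>r = 0\<close>.\<close>

lemma proportional:
  assumes "p \<in> R" "q \<in> R" "r \<in> R" "q \<noteq> 0" "r \<noteq> 0" "s \<in> R"
    and "\<And>y. y \<in> R \<Longrightarrow> p * y * r = q * y * s"
  obtains k where "k \<in> K" "p = k * q"
proof -
  have "p \<in> kspan K [q]"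
    using indep_coefficients_zero[of "[(p, r), (q, - s)]"] assms by auto
  with that show thesis by auto
qed

text \<open>
  The flip descends to operators because a linear dependence between the left factors can be
  eliminated simultaneously in an operator and its flip.
\<close>

lemma sandwich_absorb:
  assumes "set ps \<subseteq> R \<times> R" "a \<in> kspan K (map fst ps)" "b \<in> R"
  shows "\<exists>qs. set qs \<subseteq> R \<times> R \<and> map fst qs = map fst ps \<and>
    (\<forall>y\<in>R. sandwich qs y = a * y * b + sandwich ps y) \<and>
    (\<forall>y\<in>R. sandwich (flip qs) y = b * y * a + sandwich (flip ps) y)"
  using assms(1,2)
proof (induction ps arbitrary: a)
  case Nil
  then show ?case by (auto intro!: exI[of _ "[]"])
next
  case (Cons p ps)
  obtain c d where p: "p = (c, d)" by (cases p)
  with Cons.prems obtain k s where a: "a = k * c + s" "k \<in> K" "s \<in> kspan K (map fst ps)"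
    by auto
  from Cons obtain qs where qs: "set qs \<subseteq> R \<times> R" "map fst qs = map fst ps"
    "\<forall>y\<in>R. sandwich qs y = s * y * b + sandwich ps y"
    "\<forall>y\<in>R. sandwich (flip qs) y = b * y * s + sandwich (flip ps) y"
    using a(3) by (metis insert_subset list.simps(15))
  have cd: "c \<in> R" "d \<in> R" "k \<in> R" using Cons.prems p a by (auto simp: K_sub)
  have com: "r * k = k * r" "r * (k * r') = k * (r * r')" if "r \<in> R" for r r'
    using K_commute[OF a(2) that] by (auto simp flip: mult.assoc)
  \<comment> \<open>Since \<open>k\<close> is central,
    \<open>k * c * y * b = c * y * (k * b)\<close>: adding \<open>k * b\<close> to \<open>d\<close>
    absorbs the part \<open>k * c\<close> of \<open>a\<close>. In the flip the same change adds
    \<open>b * y * (k * c)\<close>.\<close>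
  show ?case
    using qs cd assms(3) p a(1)
    by (intro exI[of _ "(c, d + k * b) # qs"]) (auto simp: algebra_simps com)
qed

text \<open>Pairs are added one at a time; a dependent left factor is merged into the earlier ones
  by \<open>sandwich_absorb\<close>, which keeps track of the flip.\<close>

lemma indep_representative:
  assumes "set ps \<subseteq> R \<times> R"
  shows "\<exists>qs. set qs \<subseteq> R \<times> R \<and> kindep K (map fst qs) \<and>
    (\<forall>y\<in>R. sandwich qs y = sandwich ps y) \<and>
    (\<forall>y\<in>R. sandwich (flip qs) y = sandwich (flip ps) y)"
  using assms
proof (induction ps)
  case Nil
  then show ?case by (auto intro!: exI[of _ "[]"])
next
  case (Cons p ps)
  obtain a b where p: "p = (a, b)" by (cases p)
  from Cons obtain qs where qs: "set qs \<subseteq> R \<times> R" "kindep K (map fst qs)"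
    "\<forall>y\<in>R. sandwich qs y = sandwich ps y"
    "\<forall>y\<in>R. sandwich (flip qs) y = sandwich (flip ps) y"
    by auto
  show ?case
  proof (cases "a \<in> kspan K (map fst qs)")
    case True
    then show ?thesis using sandwich_absorb[OF qs(1) True, of b] qs Cons.prems p by auto
  next
    case False
    then show ?thesis using qs Cons.prems p by (intro exI[of _ "(a, b) # qs"]) auto
  qed
qed

text \<open>With independent left factors all right factors are zero, and so the flip is zero as
  well. Hence the flip depends only on the operator and not on the way it is written.\<close>

lemma flip_zero:
  assumes "set ps \<subseteq> R \<times> R" "\<And>y. y \<in> R \<Longrightarrow> sandwich ps y = 0" "y \<in> R"
  shows "sandwich (flip ps) y = 0"
proof -
  obtain qs where qs: "set qs \<subseteq> R \<times> R" "kindep K (map fst qs)"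
    "\<forall>y\<in>R. sandwich qs y = sandwich ps y"
    "\<forall>y\<in>R. sandwich (flip qs) y = sandwich (flip ps) y"
    using indep_representative[OF assms(1)] by blast
  then have "\<forall>q\<in>set qs. snd q = 0"
    using indep_coefficients_zero[of qs] assms(2) by simp
  then have "sandwich (flip qs) y = 0" by (induction qs) auto
  with qs(4) assms(3) show ?thesis by simp
qed

text \<open>The flip is an involution, so \<open>flip_zero\<close> can be applied backwards.\<close>

lemma flip_nonzero:
  assumes "set ps \<subseteq> R \<times> R" "x \<in> R" "sandwich ps x \<noteq> 0"
  obtains y where "y \<in> R" "sandwich (flip ps) y \<noteq> 0"
  using flip_zero[of "flip ps" x] flip_closed[OF assms(1)] assms by (auto simp: o_def)

text \<open>
  Razmyslov's duality: an operator maps into the centre iff its flip annihilates commutators.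
\<close>

lemma flip_central:
  assumes "set ps \<subseteq> R \<times> R" "\<And>x. x \<in> commutators R \<Longrightarrow> sandwich ps x = 0" "y \<in> R"
  shows "sandwich (flip ps) y \<in> K"
proof -
  have "sandwich (flip ps) y * r = r * sandwich (flip ps) y" if r: "r \<in> R" for r
  proof -
    \<comment> \<open>This is \<open>x \<mapsto> sandwich ps (r * x - x * r)\<close>, which vanishes
      on \<open>R\<close>; its flip is the commutator of \<open>sandwich (flip ps) y\<close> with
      \<open>r\<close>.\<close>
    define qs where "qs = map (\<lambda>(a, b). (a * r, b)) ps @ map (\<lambda>(a, b). (- a, r * b)) ps"
    have "sandwich qs x = sandwich ps (r * x - x * r)" for x
      unfolding qs_def by (induction ps) (auto simp: sandwich_append algebra_simps)
    moreover have "r * x - x * r \<in> commutators R" if "x \<in> R" for x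
      using that r by (auto simp: commutators_def)
    moreover have "set qs \<subseteq> R \<times> R" using assms(1) r by (auto simp: qs_def)
    ultimately have "sandwich (flip qs) y = 0"
      using assms(2,3) by (intro flip_zero) auto
    moreover have "sandwich (flip qs) y = sandwich (flip ps) y * r - r * sandwich (flip ps) y"
      unfolding qs_def by (induction ps) (auto simp: sandwich_append algebra_simps)
    ultimately show ?thesis by simp
  qed
  then show ?thesis using assms(1,3) flip_closed by (intro K_I) auto
qed

text \<open>The other half of the duality: the commutator of \<open>r\<close> with
  \<open>sandwich ps y\<close> is a vanishing operator in \<open>y\<close>, and its flip sends
  \<open>s\<close> to the value of \<open>flip ps\<close> at \<open>s * r - r * s\<close>.\<close>

lemma flip_commutator:
  assumes "set ps \<subseteq> R \<times> R" "\<And>y. y \<in> R \<Longrightarrow> sandwich ps y \<in> K" "x \<in> commutators R"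
  shows "sandwich (flip ps) x = 0"
proof -
  obtain r s where x: "x = r * s - s * r" and rs: "r \<in> R" "s \<in> R"
    using assms(3) by (auto simp: commutators_def)
  define qs where "qs = map (\<lambda>(a, b). (r * a, b)) ps @ map (\<lambda>(a, b). (- a, b * r)) ps"
  have "sandwich qs y = r * sandwich ps y - sandwich ps y * r" for y
    unfolding qs_def by (induction ps) (auto simp: sandwich_append algebra_simps)
  moreover have "set qs \<subseteq> R \<times> R" using assms(1) rs by (auto simp: qs_def)
  moreover have "r * sandwich ps y = sandwich ps y * r" if "y \<in> R" for y
    using K_commute[OF assms(2)[OF that] rs(1)] .
  ultimately have "sandwich (flip qs) s = 0"
    using rs by (intro flip_zero) auto
  moreover have "sandwich (flip qs) s = sandwich (flip ps) (s * r - r * s)"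
    unfolding qs_def by (induction ps) (auto simp: sandwich_append algebra_simps)
  ultimately show ?thesis
    using sandwich_diff[of "flip ps" "s * r" "r * s"] sandwich_diff[of "flip ps" "r * s" "s * r"]
    by (simp add: x)
qed

section \<open>Elimination operators detect dependence\<close>

lemma elim_ops_closed: "elim_ops R us L \<Longrightarrow> set L \<subseteq> R \<times> R"
proof (induction rule: elim_ops.induct)
  case (Cons us L L' y u)
  then have "sandwich L u \<in> R" "sandwich L' u \<in> R" by auto
  with Cons show ?case by (auto simp: elim_step_def)
qed simp

text \<open>At \<open>x = u\<close> the two terms of \<open>elim_step\<close> cancel, and on the
  rest of the list \<open>L\<close> and \<open>L'\<close> vanish by induction.\<close>

lemma elim_ops_kspan:
  assumes "elim_ops R us L" "set us \<subseteq> R" "x \<in> kspan K us"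
  shows "sandwich L x = 0"
proof -
  have "sandwich L u = 0" if "u \<in> set us" for u
    using assms(1) that
    by (induction rule: elim_ops.induct) (auto simp: sandwich_elim_step)
  with assms elim_ops_closed[OF assms(1)] show ?thesis by (blast intro: sandwich_kspan)
qed

text \<open>The analogue of alternation: if \<open>u\<close> depends on the rest, then
  \<open>L\<close> and \<open>L'\<close> kill \<open>u\<close>, and each term of the step has such a
  factor. Otherwise the rest is dependent and \<open>L\<close>, \<open>L'\<close> are zero by
  induction.\<close>

lemma elim_ops_dependent:
  assumes "elim_ops R us L" "set us \<subseteq> R" "\<not> kindep K us"
  shows "sandwich L x = 0"
  using assms
proof (induction arbitrary: x rule: elim_ops.induct)
  case (Cons us L L' y u)
  show ?case
  proof (cases "u \<in> kspan K us")
    case True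
    then have "sandwich L u = 0" "sandwich L' u = 0"
      using Cons elim_ops_kspan by auto
    then show ?thesis by (simp add: sandwich_elim_step)
  next
    case False
    then have "sandwich L x = 0" "sandwich L' x = 0" for x
      using Cons.IH Cons.prems by auto
    then show ?thesis by (simp add: sandwich_elim_step)
  qed
qed simp

text \<open>The common kernel is no larger than the span. If every step kills \<open>x\<close>, then
  all values \<open>L x\<close> are the same central multiple \<open>k\<close> of
  \<open>L u\<close>, so the shorter operators kill \<open>x - k * u\<close> and induction
  applies.\<close>

lemma elim_ops_separating:
  assumes "set us \<subseteq> R" "kindep K us" "x \<in> R" "x \<notin> kspan K us"
  shows "\<exists>L. elim_ops R us L \<and> sandwich L x \<noteq> 0"
  using assms
proof (induction us arbitrary: x)
  case Nil
  then show ?case by (auto intro!: exI[of _ "[(1, 1)]"] elim_ops.Nil)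
next
  case (Cons u us)
  have us: "u \<in> R" "set us \<subseteq> R" "kindep K us" "u \<notin> kspan K us" using Cons.prems by auto
  show ?case
  proof (rule ccontr)
    assume "\<not> ?thesis"
    then have eq: "sandwich L x * y * sandwich L' u = sandwich L u * y * sandwich L' x"
      if "elim_ops R us L" "elim_ops R us L'" "y \<in> R" for L L' y
      using elim_ops.Cons[OF that us(1)] by (auto simp: sandwich_elim_step)
    obtain M where M: "elim_ops R us M" "sandwich M u \<noteq> 0" using Cons.IH us by blast
    have in_R: "sandwich L z \<in> R" if "elim_ops R us L" "z \<in> R" for L z
      using that elim_ops_closed sandwich_closed by blast
    \<comment> \<open>Here \<open>M\<close> is used for both \<open>L\<close> and \<open>L'\<close>
      in \<open>eq\<close>.\<close>
    obtain k where k: "k \<in> K" "sandwich M x = k * sandwich M u"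
      using proportional[of "sandwich M x" "sandwich M u" "sandwich M u" "sandwich M x"]
        M eq in_R us(1) Cons.prems(3) by metis
    \<comment> \<open>The factor \<open>k\<close> found for \<open>M\<close> serves every
      \<open>L\<close>: taking \<open>L' = M\<close> in \<open>eq\<close> gives
      \<open>L x * y * M u = k * L u * y * M u\<close>, and primeness cancels
      \<open>M u\<close>.\<close>
    have "sandwich L (x - k * u) = 0" if L: "elim_ops R us L" for L
    proof (rule mult_mult_zero)
      show "sandwich M u \<in> R" "sandwich M u \<noteq> 0" using M in_R us by auto
      show "sandwich L (x - k * u) \<in> R" using in_R L us(1) Cons.prems(3) K_sub k(1) by simp
      fix y assume y: "y \<in> R"
      have "sandwich L u \<in> R" using in_R L us(1) .
      then have "sandwich L u * y * (k * sandwich M u) = k * sandwich L u * y * sandwich M u"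
        using K_commute[OF k(1), of "sandwich L u * y"] y by (simp flip: mult.assoc)
      with eq[OF L M(1) y] k(2)
      have "sandwich L x * y * sandwich M u = k * sandwich L u * y * sandwich M u" by simp
      then show "sandwich L (x - k * u) * y * sandwich M u = 0"
        using sandwich_K[OF elim_ops_closed[OF L] us(1) k(1)]
        by (simp add: sandwich_diff left_diff_distrib)
    qed
    then have "x - k * u \<in> kspan K us"
      using Cons.IH[of "x - k * u"] us Cons.prems(3) K_sub[OF k(1)] by auto
    then have "x \<in> kspan K (u # us)"
      using kspan_ConsI[OF k(1), of "x - k * u" us u] by (simp del: kspan.simps)
    with Cons.prems(4) show False by blast
  qed
qed

text \<open>\<open>us\<close> has the greatest possible length, so no independent list of that
  length can be extended. The conclusion covers all such lists because the commutators in
  \<open>us\<close> will later be replaced by others.\<close>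

lemma maximal_indep:
  assumes "X \<subseteq> R"
  obtains us where "set us \<subseteq> X" "kindep K us"
    "\<And>vs. set vs \<subseteq> X \<Longrightarrow> length vs = length us \<Longrightarrow> kindep K vs \<Longrightarrow> X \<subseteq> kspan K vs"
proof -
  define P where "P n \<longleftrightarrow> (\<exists>us. set us \<subseteq> X \<and> kindep K us \<and> length us = n)" for n
  obtain N where N: "\<And>xs. set xs \<subseteq> R \<Longrightarrow> kindep K xs \<Longrightarrow> length xs \<le> N"
    using bounded_indep by blast
  have P0: "P 0" by (auto simp: P_def)
  have le: "n \<le> N" if "P n" for n using that N assms by (auto simp: P_def)
  define n where "n = (GREATEST n. P n)"
  have "P n" unfolding n_def using P0 le by (rule GreatestI_nat)
  then obtain us where us: "set us \<subseteq> X" "kindep K us" "length us = n" by (auto simp: P_def)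
  have max: "m \<le> n" if "P m" for m
    unfolding n_def using that le by (rule Greatest_le_nat)
  have "x \<in> kspan K vs"
    if "set vs \<subseteq> X" "length vs = length us" "kindep K vs" "x \<in> X" for vs x
  proof (rule ccontr)
    assume "x \<notin> kspan K vs"
    then have "P (Suc n)" using that us unfolding P_def by (intro exI[of _ "x # vs"]) auto
    with max show False by fastforce
  qed
  with us that show thesis by blast
qed

text \<open>The coordinate function of a basis vector \<open>x\<close>: an elimination operator
  kills the other basis vectors, and simplicity normalises its value at \<open>x\<close> to
  1.\<close>

lemma central_operator:
  obtains ps where "set ps \<subseteq> R \<times> R" "\<And>y. y \<in> R \<Longrightarrow> sandwich ps y \<in> K"
    "\<exists>y\<in>R. sandwich ps y \<noteq> 0"
proof -
  obtain us where us: "set us \<subseteq> R" "kindep K us" "R \<subseteq> kspan K us"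
    using maximal_indep[OF subset_refl] by metis
  have "us \<noteq> []"
  proof
    assume "us = []"
    then have "1 \<in> {0::'a}" using us(3) one_closed by (metis kspan.simps(1) subsetD)
    with one_neq_zero show False by simp
  qed
  then obtain x xs where xs: "us = x # xs" by (cases us) auto
  then obtain L where L: "elim_ops R xs L" "sandwich L x \<noteq> 0"
    using elim_ops_separating[of xs x] us(1,2) by auto
  note L_R = elim_ops_closed[OF L(1)]
  have x: "x \<in> R" "set xs \<subseteq> R" using us(1) xs by auto
  obtain qs where qs: "set qs \<subseteq> R \<times> R" "sandwich qs (sandwich L x) = 1"
    using simple[OF sandwich_closed[OF L_R x(1)] L(2)] by blast
  \<comment> \<open>The composition of \<open>qs\<close> with \<open>L\<close>, written as a single
    list of pairs.\<close>
  define ps where "ps = concat (map (\<lambda>(p, q). map (\<lambda>(a, b). (p * a, b * q)) L) qs)"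
  have ps_R: "set ps \<subseteq> R \<times> R"
    unfolding ps_def using qs(1) L_R by (induction qs) auto
  have ps: "sandwich ps y = sandwich qs (sandwich L y)" for y
    unfolding ps_def
    by (induction qs) (auto simp: sandwich_append sandwich_map_outer)
  have "sandwich ps y \<in> K" if yR: "y \<in> R" for y
  proof -
    obtain k s where y: "y = k * x + s" "k \<in> K" "s \<in> kspan K xs"
      using subsetD[OF us(3) yR] by (auto simp: xs)
    then have "sandwich ps y = k * sandwich ps x + sandwich ps s"
      using sandwich_K[OF ps_R x(1)] by (simp add: sandwich_add)
    then show ?thesis using elim_ops_kspan[OF L(1) x(2) y(3)] qs(2) y(2) by (simp add: ps)
  qed
  moreover have "sandwich ps x \<noteq> 0" using qs(2) one_neq_zero by (simp add: ps)
  ultimately show thesis using that[OF ps_R] x(1) by blast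
qed

section \<open>Commutators and the elimination of their span\<close>

lemma commutators_sub: "commutators R \<subseteq> R"
  by (auto simp: commutators_def)

text \<open>The flip of a nonzero operator with central values is nonzero, yet it kills every
  combination of commutators.\<close>

lemma kspan_commutators_proper:
  assumes "set us \<subseteq> commutators R"
  shows "\<exists>x\<in>R. x \<notin> kspan K us"
proof -
  obtain ps where ps: "set ps \<subseteq> R \<times> R" "\<And>y. y \<in> R \<Longrightarrow> sandwich ps y \<in> K"
    "\<exists>y\<in>R. sandwich ps y \<noteq> 0"
    by (rule central_operator) blast
  obtain x where x: "x \<in> R" "sandwich (flip ps) x \<noteq> 0" using ps flip_nonzero by metis
  have "set us \<subseteq> R" using assms commutators_sub by (rule subset_trans)
  moreover have "sandwich (flip ps) u = 0" if "u \<in> set us" for u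
    using assms that by (intro flip_commutator[OF ps(1,2)]) auto
  ultimately have "x \<notin> kspan K us"
    using sandwich_kspan[OF flip_closed[OF ps(1)], of us x] x(2) by metis
  with x(1) show ?thesis by blast
qed

lemma elim_ops_commutators:
  assumes "elim_ops R us L" "set us \<subseteq> commutators R"
    and "kindep K us \<Longrightarrow> commutators R \<subseteq> kspan K us"
    and "x \<in> commutators R"
  shows "sandwich L x = 0"
proof -
  have us: "set us \<subseteq> R" using assms(2) commutators_sub by (rule subset_trans)
  show ?thesis
  proof (cases "kindep K us")
    case True
    with assms(3,4) elim_ops_kspan[OF assms(1) us] show ?thesis by auto
  qed (use elim_ops_dependent[OF assms(1) us] in auto)
qed

end

section \<open>Specialisation of central expressions\<close>

abbreviation map2pairs :: "('b \<Rightarrow> 'a) \<Rightarrow> ('b \<times> 'b) list \<Rightarrow> ('a \<times> 'a) list" where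
  "map2pairs h \<equiv> map (map_prod h h)"

locale ring_hom =
  fixes h :: "'b::ring_1 \<Rightarrow> 'a::{ring,monoid_mult}"
  assumes hom_add: "h (x + y) = h x + h y"
    and hom_mult: "h (x * y) = h x * h y"
    and hom_one: "h 1 = 1"
begin

lemma hom_zero: "h 0 = 0"
  using hom_add[of 0 0] by simp

lemma hom_uminus: "h (- x) = - h x"
  using hom_add[of x "- x"] by (simp add: hom_zero eq_neg_iff_add_eq_0 add.commute)

lemma hom_diff: "h (x - y) = h x - h y"
  using hom_add[of x "- y"] by (simp add: hom_uminus)

lemma hom_commutators: "commutators (range h) = h ` commutators UNIV"
proof
  show "commutators (range h) \<subseteq> h ` commutators UNIV"
  proof
    fix y assume "y \<in> commutators (range h)"
    then obtain r s where "y = h (r * s - s * r)"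
      by (auto simp: commutators_def hom_diff hom_mult)
    then show "y \<in> h ` commutators UNIV" by (auto simp: commutators_def)
  qed
  show "h ` commutators UNIV \<subseteq> commutators (range h)"
  proof
    fix y assume "y \<in> h ` commutators UNIV"
    then obtain r s where "y = h (r * s - s * r)" by (auto simp: commutators_def)
    then show "y \<in> commutators (range h)" by (auto simp: commutators_def hom_diff hom_mult)
  qed
qed

lemma hom_sandwich: "h (sandwich ps x) = sandwich (map2pairs h ps) (h x)"
  by (induction ps) (auto simp: hom_add hom_mult hom_zero)

lemma hom_elim_ops:
  assumes "elim_ops UNIV us L" "range h \<subseteq> R"
  shows "elim_ops R (map h us) (map2pairs h L)"
  using assms(1)
proof (induction rule: elim_ops.induct)
  case Nil
  then show ?case by (simp add: hom_one elim_ops.Nil)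
next
  case (Cons us L L' y u)
  have "map2pairs h (elim_step L L' u y) =
      elim_step (map2pairs h L) (map2pairs h L') (h u) (h y)"
    by (auto simp: elim_step_def hom_mult hom_uminus hom_sandwich)
  moreover have "h y \<in> R" "h u \<in> R" using assms(2) by auto
  ultimately show ?case using elim_ops.Cons[OF Cons.IH] by simp
qed

text \<open>All ring elements used to build \<open>L\<close> have preimages under \<open>h\<close>.
  The lift \<open>M\<close> is a formal expression to which other homomorphisms can then be
  applied.\<close>

lemma lift_elim_ops:
  assumes "elim_ops R (map h us) L" "R \<subseteq> range h"
  shows "\<exists>M. elim_ops UNIV us M \<and> L = map2pairs h M"
  using assms(1)
proof (induction "map h us" L arbitrary: us rule: elim_ops.induct)
  case Nil
  have "map2pairs h [(1, 1)] = [(1, 1)]" by (simp add: hom_one)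
  with Nil elim_ops.Nil[of UNIV] show ?case by (metis map_is_Nil_conv)
next
  case (Cons vs L L' y v)
  obtain u us' where us: "us = u # us'" "v = h u" "vs = map h us'"
    using Cons.hyps(7) by (cases us) auto
  obtain M M' where M: "elim_ops UNIV us' M" "L = map2pairs h M"
    "elim_ops UNIV us' M'" "L' = map2pairs h M'"
    using Cons.hyps(2)[OF us(3)] Cons.hyps(4)[OF us(3)] by blast
  obtain z where z: "y = h z" using Cons.hyps(5) assms(2) by blast
  have "elim_step L L' v y = map2pairs h (elim_step M M' u z)"
    by (auto simp: elim_step_def hom_mult hom_uminus hom_sandwich M(2,4) z us(2))
  with elim_ops.Cons[OF M(1,3) UNIV_I UNIV_I, of u z] us(1) show ?case by metis
qed

end

text \<open>For \<open>'b\<close> the free algebra, the homomorphisms \<open>h\<close> are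
  substitutions and \<open>h0\<close> is one that reaches all of \<open>R\<close>. The expression is
  the flip of a lifted elimination operator for a maximal independent list of commutators.\<close>

lemma (in simple_subring) central_expression:
  fixes h0 :: "'b::ring_1 \<Rightarrow> 'a"
  assumes "ring_hom h0" "range h0 = R"
  obtains ps where "\<And>h x. ring_hom h \<Longrightarrow> range h \<subseteq> R \<Longrightarrow> h (sandwich ps x) \<in> K"
    and "\<exists>r\<in>R. sandwich (map2pairs h0 ps) r \<noteq> 0"
proof -
  interpret h0: ring_hom h0 by fact
  obtain us where us: "set us \<subseteq> commutators R" "kindep K us"
    and max: "\<And>vs. set vs \<subseteq> commutators R \<Longrightarrow> length vs = length us \<Longrightarrow> kindep K vs \<Longrightarrow>
      commutators R \<subseteq> kspan K vs"
    using maximal_indep[OF commutators_sub] by blast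
  obtain x where x: "x \<in> R" "x \<notin> kspan K us"
    using kspan_commutators_proper[OF us(1)] by blast
  have us_R: "set us \<subseteq> R" using us(1) commutators_sub by blast
  obtain L where L: "elim_ops R us L" "sandwich L x \<noteq> 0"
    using elim_ops_separating[OF us_R us(2) x] by blast
  \<comment> \<open>The chosen commutators are lifted to commutators, so that every \<open>h\<close>
    sends them to commutators again.\<close>
  have "commutators R = h0 ` commutators UNIV"
    using h0.hom_commutators assms(2) by simp
  with us(1) have "us \<in> lists (h0 ` commutators UNIV)" by (auto simp: in_lists_conv_set)
  then obtain vs where vs: "set vs \<subseteq> commutators UNIV" "us = map h0 vs"
    by (auto simp: lists_image in_lists_conv_set subset_iff)
  obtain M where M: "elim_ops UNIV vs M" "L = map2pairs h0 M"
    using h0.lift_elim_ops[of R vs L] L(1) vs(2) assms(2) by auto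
  have "h (sandwich (flip M) y) \<in> K" if h: "ring_hom h" "range h \<subseteq> R" for h y
  proof -
    interpret h: ring_hom h by fact
    have L': "elim_ops R (map h vs) (map2pairs h M)" by (rule h.hom_elim_ops[OF M(1) h(2)])
    have c: "set (map h vs) \<subseteq> commutators R"
    proof -
      have "set (map h vs) \<subseteq> commutators (range h)"
        using vs(1) by (auto simp: h.hom_commutators)
      also have "\<dots> \<subseteq> commutators R" using h(2) by (rule commutators_mono)
      finally show ?thesis .
    qed
    \<comment> \<open>The list \<open>map h vs\<close> is as long as \<open>us\<close>: if
      independent it spans all commutators by maximality, and if dependent the operator is
      zero.\<close>
    have "sandwich (map2pairs h M) z = 0" if "z \<in> commutators R" for z
      using elim_ops_commutators[OF L' c _ that] max[OF c] vs(2) by simp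
    then have "sandwich (flip (map2pairs h M)) (h y) \<in> K"
      using flip_central[OF elim_ops_closed[OF L']] h(2) by blast
    moreover have "flip (map2pairs h M) = map2pairs h (flip M)" by auto
    ultimately show ?thesis by (simp add: h.hom_sandwich del: map_map)
  qed
  moreover have "\<exists>r\<in>R. sandwich (map2pairs h0 (flip M)) r \<noteq> 0"
  proof -
    obtain r where "r \<in> R" "sandwich (flip L) r \<noteq> 0"
      using flip_nonzero[OF elim_ops_closed[OF L(1)] x(1) L(2)] .
    moreover have "flip L = map2pairs h0 (flip M)" by (auto simp: M(2))
    ultimately show ?thesis by metis
  qed
  ultimately show thesis using that by blast
qed


section \<open>The ring of additive endomorphisms\<close>

text \<open>Only additivity is built into the type, because \<open>scale\<close> is a parameter of a
  locale; linearity becomes the predicate \<open>linear_endo\<close>.\<close>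

typedef (overloaded) 'w endo = "{f :: 'w::ab_group_add \<Rightarrow> 'w. \<forall>x y. f (x + y) = f x + f y}"
  morphisms app Endo
  by (rule exI[of _ id]) simp

setup_lifting type_definition_endo

lemma app_add: "app f (x + y) = app f x + app f y"
  using app[of f] by simp

lemma app_zero [simp]: "app f 0 = 0"
  using app_add[of f 0 0] by simp

lemma app_diff: "app f (x - y) = app f x - app f y"
  using app_add[of f "x - y" y] by simp

text \<open>Over the trivial group 1 equals 0, so the class \<open>ring_1\<close> is out of
  reach.\<close>

instantiation endo :: (ab_group_add) "{ring, monoid_mult}"
begin

lift_definition zero_endo :: "'a endo" is "\<lambda>w. 0" by simp
lift_definition one_endo :: "'a endo" is "\<lambda>w. w" by simp
lift_definition plus_endo :: "'a endo \<Rightarrow> 'a endo \<Rightarrow> 'a endo" is "\<lambda>f g w. f w + g w"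
  by (simp add: algebra_simps)
lift_definition minus_endo :: "'a endo \<Rightarrow> 'a endo \<Rightarrow> 'a endo" is "\<lambda>f g w. f w - g w"
  by (simp add: algebra_simps)
lift_definition uminus_endo :: "'a endo \<Rightarrow> 'a endo" is "\<lambda>f w. - f w"
  by simp
lift_definition times_endo :: "'a endo \<Rightarrow> 'a endo \<Rightarrow> 'a endo" is "\<lambda>f g w. f (g w)"
  by simp

instance
  by standard (transfer; simp add: fun_eq_iff algebra_simps)+

end

lemmas app_simps [simp] =
  zero_endo.rep_eq one_endo.rep_eq plus_endo.rep_eq minus_endo.rep_eq uminus_endo.rep_eq
  times_endo.rep_eq

lemma endo_eqI: "(\<And>w. app f w = app g w) \<Longrightarrow> f = g"
  by (simp add: app_inject[symmetric] fun_eq_iff)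

lemma app_sum: "app (sum f S) w = (\<Sum>i\<in>S. app (f i) w)"
  by (induction S rule: infinite_finite_induct) auto


section \<open>Scalars and the evaluation of polynomials at operators\<close>

locale endo_space = vector_space scale
  for scale :: "'a::field \<Rightarrow> 'b::ab_group_add \<Rightarrow> 'b"
begin

text \<open>Scalars are made ring elements: linearity is commutation with them, and scaling an
  operator is a product.\<close>

definition scal :: "'a \<Rightarrow> 'b endo" where
  "scal a = Endo (scale a)"

lemma app_scal: "app (scal a) = scale a"
  unfolding scal_def by (simp add: Endo_inverse scale_right_distrib)

definition linear_endo :: "'b endo \<Rightarrow> bool" where
  "linear_endo f \<longleftrightarrow> (\<forall>a. scal a * f = f * scal a)"

lemma scal_simps: "scal (a + b) = scal a + scal b" "scal (a * b) = scal a * scal b"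
  "scal 0 = 0" "scal 1 = 1" "scal a * scal b = scal b * scal a"
  by (rule endo_eqI; simp add: app_scal scale_left_distrib mult.commute)+

lemma linear_endoD: "linear_endo f \<Longrightarrow> app f (scale a w) = scale a (app f w)"
  unfolding linear_endo_def using app_scal by (metis times_endo.rep_eq)

lemma linear_endo_iff: "linear_endo f \<longleftrightarrow> Vector_Spaces.linear scale scale (app f)"
proof
  assume "linear_endo f"
  then show "Vector_Spaces.linear scale scale (app f)"
    by unfold_locales (auto simp: app_add linear_endoD)
next
  assume "Vector_Spaces.linear scale scale (app f)"
  then interpret Vector_Spaces.linear scale scale "app f" .
  show "linear_endo f" unfolding linear_endo_def
    by (auto intro!: endo_eqI simp: app_scal scale)
qed

lemma vector_space_endo: "vector_space (\<lambda>a f. scal a * f)"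
  by unfold_locales (auto simp: scal_simps algebra_simps)

definition word_value :: "(nat \<Rightarrow> 'b endo) \<Rightarrow> nc_word \<Rightarrow> 'b endo" where
  "word_value v u = prod_list (map v (letters u))"

definition poly_value :: "(nat \<Rightarrow> 'b endo) \<Rightarrow> 'a nc_poly \<Rightarrow> 'b endo" where
  "poly_value v p = (\<Sum>u\<in>Poly_Mapping.keys p. scal (Poly_Mapping.lookup p u) * word_value v u)"

lemma app_word_value: "app (word_value v u) = word_eval (app \<circ> v) u"
proof -
  have "app (prod_list (map v is)) = foldr (\<lambda>i g. (app \<circ> v) i \<circ> g) is id" for "is"
    by (induction "is") (auto simp: fun_eq_iff)
  then show ?thesis by (simp add: word_value_def word_eval_def)
qed

lemma app_poly_value: "app (poly_value v p) = nc_eval scale p (app \<circ> v)"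
  by (rule ext) (simp add: poly_value_def nc_eval_def app_sum app_scal app_word_value)

lemma word_value_plus: "word_value v (u + u') = word_value v u * word_value v u'"
  by (simp add: word_value_def plus_nc_word_def)

text \<open>Lets the sums for \<open>p\<close>, \<open>q\<close> and \<open>p + q\<close> run over
  one common index set.\<close>

lemma poly_value_superset:
  assumes "finite S" "Poly_Mapping.keys p \<subseteq> S"
  shows "poly_value v p = (\<Sum>u\<in>S. scal (Poly_Mapping.lookup p u) * word_value v u)"
  unfolding poly_value_def
  by (rule sum.mono_neutral_left[OF assms]) (simp add: in_keys_iff scal_simps)

lemma poly_value_add: "poly_value v (p + q) = poly_value v p + poly_value v q"
proof -
  define S where "S = Poly_Mapping.keys p \<union> Poly_Mapping.keys q"
  have "finite S" "Poly_Mapping.keys p \<subseteq> S" "Poly_Mapping.keys q \<subseteq> S"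
    "Poly_Mapping.keys (p + q) \<subseteq> S"
    using Poly_Mapping.keys_add[of p q] by (auto simp: S_def)
  then show ?thesis
    by (simp add: poly_value_superset[of S] lookup_add scal_simps distrib_right sum.distrib)
qed

lemma poly_value_single: "poly_value v (Poly_Mapping.single u a) = scal a * word_value v u"
  using poly_value_superset[of "{u}" "Poly_Mapping.single u a" v] by simp

lemma poly_mapping_additive_induct [case_names single add]:
  fixes p :: "'x \<Rightarrow>\<^sub>0 'y::comm_monoid_add"
  assumes "\<And>u a. P (Poly_Mapping.single u a)" "\<And>p q. P p \<Longrightarrow> P q \<Longrightarrow> P (p + q)"
  shows "P p"
proof (induction p rule: update_induct)
  case const
  show ?case using assms(1)[of _ 0] by simp
next
  case (update f k v)
  have "Poly_Mapping.update k v f = f + Poly_Mapping.single k v"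
    using update(1) by (intro poly_mapping_eqI)
      (auto simp: lookup_update lookup_add lookup_single in_keys_iff when_def)
  with update assms show ?case by simp
qed

lemma linear_endo_word_value:
  assumes "\<And>i. linear_endo (v i)"
  shows "scal a * word_value v u = word_value v u * scal a"
proof -
  have "scal a * prod_list (map v is) = prod_list (map v is) * scal a" for "is"
  proof (induction "is")
    case (Cons i "is")
    have "scal a * v i = v i * scal a" using assms by (simp add: linear_endo_def)
    then have "scal a * (v i * prod_list (map v is)) = v i * (scal a * prod_list (map v is))"
      by (simp flip: mult.assoc)
    with Cons show ?case by (simp add: mult.assoc)
  qed simp
  then show ?thesis by (simp add: word_value_def)
qed

text \<open>By additivity it suffices to treat monomials, where linearity of the \<open>v i\<close>
  moves the second coefficient past the first word.\<close>

lemma poly_value_mult: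
  assumes "\<And>i. linear_endo (v i)"
  shows "poly_value v (p * q) = poly_value v p * poly_value v q"
proof (induction p rule: poly_mapping_additive_induct)
  case (single u a)
  show ?case
  proof (induction q rule: poly_mapping_additive_induct)
    case (single u' b)
    have "scal (a * b) * (word_value v u * word_value v u') =
        scal a * (scal b * word_value v u) * word_value v u'"
      by (simp add: scal_simps mult.assoc)
    also have "\<dots> = scal a * word_value v u * (scal b * word_value v u')"
      using linear_endo_word_value[of v b u] assms by (simp add: mult.assoc)
    finally show ?case by (simp add: mult_single poly_value_single word_value_plus)
  qed (simp add: poly_value_add distrib_left)
qed (simp add: poly_value_add distrib_right)

lemma ring_hom_poly_value:
  assumes "\<And>i. linear_endo (v i)"
  shows "ring_hom (poly_value v)"
proof
  have "poly_value v (Poly_Mapping.single 0 1) = 1"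
    by (simp add: poly_value_single scal_simps word_value_def zero_nc_word_def)
  then show "poly_value v 1 = 1" by simp
qed (simp_all add: poly_value_add poly_value_mult[OF assms])

lemma poly_value_variable: "poly_value v (Poly_Mapping.single (Word [i]) 1) = v i"
  by (simp add: poly_value_single scal_simps word_value_def)

end

locale finite_dim_endo_space = endo_space scale + finite_dimensional_vector_space scale Basis
  for scale :: "'a::field \<Rightarrow> 'b::ab_group_add \<Rightarrow> 'b" and Basis
begin

lemma linear_endo_finite_span:
  obtains T where "finite T" "\<And>f. linear_endo f \<Longrightarrow> f \<in> module.span (\<lambda>a f. scal a * f) T"
proof -
  interpret E: vector_space "\<lambda>a f. scal a * f" by (rule vector_space_endo)
  \<comment> \<open>Matrix units: \<open>e b c\<close> multiplies the \<open>b\<close>-coordinate of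
    a vector by \<open>c\<close>.\<close>
  define e where "e b c = Endo (\<lambda>w. scale (representation Basis w b) c)" for b c
  have in_span: "w \<in> span Basis" for w by (simp add: span_Basis)
  have e: "app (e b c) w = scale (representation Basis w b) c" for b c w
    unfolding e_def
    by (subst Endo_inverse)
      (simp_all add: representation_add independent_Basis in_span scale_left_distrib)
  have expand: "(\<Sum>b\<in>Basis. scale (representation Basis w b) b) = w" for w
    by (rule sum_representation_eq) (auto simp: independent_Basis in_span finite_Basis)
  have "f \<in> E.span ((\<lambda>(b, c). e b c) ` (Basis \<times> Basis))" if "linear_endo f" for f
  proof -
    have "f = (\<Sum>b\<in>Basis. \<Sum>c\<in>Basis. scal (representation Basis (app f b) c) * e b c)"
    proof (rule endo_eqI)
      fix w
      interpret f: Vector_Spaces.linear scale scale "app f" using that by (simp add: linear_endo_iff)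
      have "app f w = (\<Sum>b\<in>Basis. scale (representation Basis w b) (app f b))"
        by (subst expand[of w, symmetric]) (simp add: f.sum f.scale)
      also have "\<dots> = (\<Sum>b\<in>Basis. scale (representation Basis w b)
          (\<Sum>c\<in>Basis. scale (representation Basis (app f b) c) c))"
        by (simp add: expand)
      also have "\<dots> = app (\<Sum>b\<in>Basis. \<Sum>c\<in>Basis. scal (representation Basis (app f b) c) * e b c) w"
        by (simp add: app_sum app_scal e scale_sum_right mult.commute)
      finally show "app f w = \<dots>" .
    qed
    also have "\<dots> \<in> E.span ((\<lambda>(b, c). e b c) ` (Basis \<times> Basis))"
      by (intro E.span_sum E.span_scale E.span_base) auto
    finally show ?thesis .
  qed
  with that[of "(\<lambda>(b, c). e b c) ` (Basis \<times> Basis)"] show thesis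
    by (simp add: finite_Basis)
qed

end


section \<open>Irreducible algebras of operators\<close>

locale irreducible_algebra = finite_dim_endo_space scale Basis
  for scale :: "'a::field \<Rightarrow> 'b::ab_group_add \<Rightarrow> 'b" and Basis +
  fixes A :: "('b \<Rightarrow> 'b) set"
  assumes subalgebra: "End_subalgebra scale A"
    and nontrivial: "\<exists>w::'b. w \<noteq> 0"
    and irreducible:
      "subspace U \<Longrightarrow> (\<And>f u. f \<in> A \<Longrightarrow> u \<in> U \<Longrightarrow> f u \<in> U) \<Longrightarrow> U = {0} \<or> U = UNIV"
begin

definition R :: "'b endo set" where
  "R = {f. app f \<in> A}"

definition K :: "'b endo set" where
  "K = {k \<in> R. \<forall>r\<in>R. k * r = r * k}"

lemma app_R: "app ` R = A"
proof
  show "A \<subseteq> app ` R"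
  proof
    fix f assume f: "f \<in> A"
    then interpret Vector_Spaces.linear scale scale f
      using subalgebra by (auto simp: End_subalgebra_def)
    have "app (Endo f) = f" by (simp add: Endo_inverse add)
    with f show "f \<in> app ` R" unfolding R_def by (metis imageI mem_Collect_eq)
  qed
qed (auto simp: R_def)

lemma R_cases:
  assumes "f \<in> A"
  obtains g where "g \<in> R" "f = app g"
proof -
  have "f \<in> app ` R" using assms by (simp only: app_R)
  then obtain g where "f = app g" "g \<in> R" by (rule imageE)
  with that show thesis by simp
qed

lemma R_linear: "f \<in> R \<Longrightarrow> linear_endo f"
  using subalgebra by (simp add: R_def End_subalgebra_def linear_endo_iff)

lemma R_one: "1 \<in> R"
  using subalgebra by (simp add: R_def End_subalgebra_def one_endo.rep_eq id_def)

lemma R_add: "f \<in> R \<Longrightarrow> g \<in> R \<Longrightarrow> f + g \<in> R"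
  using subalgebra by (simp add: R_def End_subalgebra_def plus_endo.rep_eq)

lemma R_mult: "f \<in> R \<Longrightarrow> g \<in> R \<Longrightarrow> f * g \<in> R"
  using subalgebra by (simp add: R_def End_subalgebra_def times_endo.rep_eq o_def)

lemma R_scal_mult: "f \<in> R \<Longrightarrow> scal a * f \<in> R"
  using subalgebra by (simp add: R_def End_subalgebra_def times_endo.rep_eq app_scal)

lemma R_scal: "scal a \<in> R"
  using R_scal_mult[OF R_one] by simp

lemma R_zero: "0 \<in> R"
  using R_scal[of 0] by (simp add: scal_simps)

lemma R_uminus: "f \<in> R \<Longrightarrow> - f \<in> R"
proof -
  have "scal (- 1) + 1 = 0" using scal_simps(1)[of "- 1" 1] by (simp add: scal_simps)
  then have "scal (- 1) = - 1" by (simp add: eq_neg_iff_add_eq_0)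
  then show "f \<in> R \<Longrightarrow> - f \<in> R" using R_scal_mult[of f "- 1"] by simp
qed

lemma R_poly_value: "range v \<subseteq> R \<Longrightarrow> poly_value v p \<in> R"
proof -
  assume v: "range v \<subseteq> R"
  have "prod_list (map v is) \<in> R" for "is"
    using v by (induction "is") (auto simp: R_one intro: R_mult)
  then have "word_value v u \<in> R" for u by (simp add: word_value_def)
  then have "(\<Sum>u\<in>S. scal (Poly_Mapping.lookup p u) * word_value v u) \<in> R" for S
    by (induction S rule: infinite_finite_induct) (auto simp: R_zero R_add R_scal_mult)
  then show ?thesis by (simp add: poly_value_def)
qed

section \<open>Simplicity and finite dimension over the centre\<close>

lemma irreducible_R:
  assumes "subspace U" "\<And>f u. f \<in> R \<Longrightarrow> u \<in> U \<Longrightarrow> app f u \<in> U"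
  shows "U = {0} \<or> U = UNIV"
proof (rule irreducible[OF assms(1)])
  fix f u assume f: "f \<in> A" and u: "u \<in> U"
  obtain g where g: "g \<in> R" "f = app g" using f by (rule R_cases)
  show "f u \<in> U" unfolding g(2) using g(1) u by (rule assms(2))
qed

text \<open>
  Elements of a nonzero ideal that fix more and more vectors: the vector \<open>w\<close> is either moved
  freely by the annihilator of the previous ones in the ideal, or already fixed.
\<close>

lemma ideal_contains_one:
  assumes sub: "I \<subseteq> R" and nz: "b \<in> I" "b \<noteq> 0"
    and add: "\<And>f g. f \<in> I \<Longrightarrow> g \<in> I \<Longrightarrow> f + g \<in> I"
    and left: "\<And>r f. r \<in> R \<Longrightarrow> f \<in> I \<Longrightarrow> r * f \<in> I"
    and right: "\<And>r f. r \<in> R \<Longrightarrow> f \<in> I \<Longrightarrow> f * r \<in> I"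
  shows "1 \<in> I"
proof -
  have lin: "app f (scale a w) = scale a (app f w)" if "f \<in> I" for f a w
    using that sub R_linear linear_endoD by blast
  have zero: "0 \<in> I" using left[OF R_zero nz(1)] by simp
  \<comment> \<open>The vectors killed by \<open>I\<close> form an invariant subspace, since
    \<open>I\<close> absorbs multiplication from the right; it is proper because \<open>b\<close> is
    nonzero.\<close>
  have faithful: "w = 0" if w: "\<And>f. f \<in> I \<Longrightarrow> app f w = 0" for w
  proof -
    define U where "U = {w. \<forall>f\<in>I. app f w = 0}"
    have "subspace U" by (rule subspaceI) (auto simp: U_def app_add lin)
    moreover have "app r u \<in> U" if "r \<in> R" "u \<in> U" for r u
      using that right by (force simp: U_def)
    ultimately have "U = {0} \<or> U = UNIV" by (rule irreducible_R)
    moreover have "U \<noteq> UNIV"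
    proof
      assume "U = UNIV"
      then have "app b w = 0" for w using nz(1) by (auto simp: U_def)
      then have "b = 0" by (intro endo_eqI) simp
      with nz(2) show False by simp
    qed
    ultimately show ?thesis using w by (auto simp: U_def)
  qed
  have fix_list: "\<exists>e\<in>I. \<forall>w\<in>set ws. app e w = w" for ws
  proof (induction ws)
    case Nil
    then show ?case using zero by auto
  next
    case (Cons w ws)
    then obtain e where e: "e \<in> I" "\<And>w. w \<in> set ws \<Longrightarrow> app e w = w" by blast
    \<comment> \<open>\<open>J\<close> absorbs multiplication by \<open>R\<close> from the left, so
      the orbit \<open>U\<close> of \<open>w\<close> under \<open>J\<close> is invariant.\<close>
    define J where "J = {f \<in> I. \<forall>w\<in>set ws. app f w = 0}"
    define U where "U = {app f w |f. f \<in> J}"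
    have J_add: "f + g \<in> J" if "f \<in> J" "g \<in> J" for f g
      using that add by (auto simp: J_def)
    have J_left: "r * f \<in> J" if "r \<in> R" "f \<in> J" for r f
      using that left by (auto simp: J_def)
    have "subspace U"
    proof (rule subspaceI)
      show "0 \<in> U" using zero by (auto simp: U_def J_def intro!: exI[of _ "0::'b endo"])
      show "x + y \<in> U" if "x \<in> U" "y \<in> U" for x y
      proof -
        obtain f g where "f \<in> J" "g \<in> J" "x = app f w" "y = app g w"
          using \<open>x \<in> U\<close> \<open>y \<in> U\<close> by (auto simp: U_def)
        then show ?thesis using J_add[of f g] unfolding U_def by (auto intro!: exI[of _ "f + g"])
      qed
      show "scale c x \<in> U" if x: "x \<in> U" for c x
      proof -
        obtain f where "f \<in> J" "x = app f w" using x by (auto simp: U_def)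
        then show ?thesis using J_left[OF R_scal[of c]] unfolding U_def
          by (auto intro!: exI[of _ "scal c * f"] simp: app_scal)
      qed
    qed
    moreover have "app r u \<in> U" if ru: "r \<in> R" "u \<in> U" for r u
    proof -
      obtain f where "f \<in> J" "u = app f w" using ru by (auto simp: U_def)
      then show ?thesis using J_left[OF ru(1)] unfolding U_def
        by (auto intro!: exI[of _ "r * f"])
    qed
    ultimately have "U = {0} \<or> U = UNIV" by (rule irreducible_R)
    then show ?case
    proof
      assume U: "U = UNIV"
      then have "w - app e w \<in> U" by simp
      \<comment> \<open>Adding \<open>f\<close> corrects \<open>e\<close> at \<open>w\<close>
        without changing it on \<open>ws\<close>.\<close>
      then obtain f where f: "f \<in> J" "app f w = w - app e w" by (auto simp: U_def)
      then have "e + f \<in> I" "\<forall>v\<in>set (w # ws). app (e + f) v = v"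
        using e add by (auto simp: J_def)
      then show ?thesis by blast
    next
      assume U: "U = {0}"
      \<comment> \<open>\<open>f * e - f\<close> kills \<open>ws\<close>, so it lies in
        \<open>J\<close> and must kill \<open>w\<close> too.\<close>
      have "app f (app e w - w) = 0" if f: "f \<in> I" for f
      proof -
        have "- f \<in> I" using left[OF R_uminus[OF R_one] f] by simp
        moreover have "f * e \<in> I" using right f e(1) sub by blast
        ultimately have "f * e + - f \<in> I" by (rule add[rotated])
        then have "f * e + - f \<in> J" using e(2) by (simp add: J_def)
        then have "app (f * e + - f) w \<in> U" unfolding U_def by blast
        with U show ?thesis by (simp add: app_diff)
      qed
      then have "app e w = w" using faithful[of "app e w - w"] by simp
      with e show ?thesis by auto
    qed
  qed
  obtain ws where "set ws = Basis" using finite_Basis finite_list by blast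
  then obtain e where e: "e \<in> I" "\<And>w. w \<in> Basis \<Longrightarrow> app e w = w" using fix_list[of ws] by blast
  have "subspace {w. app e w = w}"
    by (rule subspaceI) (auto simp: app_add lin[OF e(1)])
  then have "span Basis \<subseteq> {w. app e w = w}" using e(2) by (intro span_minimal) auto
  then have "e = 1" by (intro endo_eqI) (auto simp: span_Basis)
  with e(1) show ?thesis by simp
qed

text \<open>The values \<open>sandwich ps b\<close> form the two-sided ideal generated by
  \<open>b\<close>, so \<open>ideal_contains_one\<close> applies.\<close>

lemma simple_R:
  assumes "b \<in> R" "b \<noteq> 0"
  shows "\<exists>ps. set ps \<subseteq> R \<times> R \<and> sandwich ps b = 1"
proof -
  define I where "I = {sandwich ps b |ps. set ps \<subseteq> R \<times> R}"
  have "1 \<in> I"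
  proof (rule ideal_contains_one)
    have "sandwich ps b \<in> R" if "set ps \<subseteq> R \<times> R" for ps
      using that by (induction ps) (auto simp: R_zero assms(1) R_add R_mult)
    then show "I \<subseteq> R" by (auto simp: I_def)
    show "b \<in> I" unfolding I_def by (auto intro!: exI[of _ "[(1, 1)]"] simp: R_one)
    show "b \<noteq> 0" by fact
    show "f + g \<in> I" if fg: "f \<in> I" "g \<in> I" for f g
    proof -
      obtain ps qs where "f = sandwich ps b" "g = sandwich qs b"
        "set ps \<subseteq> R \<times> R" "set qs \<subseteq> R \<times> R" using fg unfolding I_def by blast
      then show ?thesis unfolding I_def
        by (auto intro!: exI[of _ "ps @ qs"] simp: sandwich_append)
    qed
    have mult: "p * f * q \<in> I" if f: "f \<in> I" and pq: "p \<in> R" "q \<in> R" for f p q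
    proof -
      obtain ps where ps: "f = sandwich ps b" "set ps \<subseteq> R \<times> R" using f by (auto simp: I_def)
      define qs where "qs = map (\<lambda>(a, b). (p * a, b * q)) ps"
      have "set qs \<subseteq> R \<times> R" using ps(2) pq R_mult by (auto simp: qs_def)
      moreover have "p * f * q = sandwich qs b" by (simp add: qs_def ps(1) sandwich_map_outer)
      ultimately show ?thesis unfolding I_def by blast
    qed
    show "r * f \<in> I" "f * r \<in> I" if "r \<in> R" "f \<in> I" for r f
      using mult[OF that(2) that(1) R_one] mult[OF that(2) R_one that(1)] by simp_all
  qed
  then obtain ps where "1 = sandwich ps b" "set ps \<subseteq> R \<times> R" unfolding I_def by blast
  then show ?thesis by metis
qed

text \<open>\<open>K\<close> contains the scalars, so a list independent over \<open>K\<close> is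
  independent over the base field, where linear endomorphisms have a finite spanning set.\<close>

lemma bounded_indep_R: "\<exists>N. \<forall>xs. set xs \<subseteq> R \<longrightarrow> kindep K xs \<longrightarrow> length xs \<le> N"
proof -
  interpret E: vector_space "\<lambda>a f. scal a * f" by (rule vector_space_endo)
  obtain T where T: "finite T" "\<And>f. linear_endo f \<Longrightarrow> f \<in> E.span T"
    by (rule linear_endo_finite_span) blast
  have scal_K: "scal a \<in> K" for a
    using R_linear by (auto simp: K_def R_scal linear_endo_def)
  have span: "E.span (set xs) \<subseteq> kspan K xs" for xs
  proof (induction xs)
    case (Cons x xs)
    show ?case
    proof
      fix y assume "y \<in> E.span (set (x # xs))"
      then obtain a where "y - scal a * x \<in> E.span (set xs)" by (auto simp: E.span_insert)
      with Cons have "y - scal a * x \<in> kspan K xs" by blast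
      then show "y \<in> kspan K (x # xs)"
        using scal_K[of a] by (force intro: exI[of _ "scal a"])
    qed
  qed simp
  have indep: "E.independent (set xs) \<and> distinct xs" if "kindep K xs" for xs
    using that
  proof (induction xs)
    case (Cons x xs)
    then have "x \<notin> E.span (set xs)" using span[of xs] by auto
    with Cons show ?case by (auto simp: E.independent_insert E.span_base)
  qed (simp add: E.independent_empty)
  have "length xs \<le> card T" if "set xs \<subseteq> R" "kindep K xs" for xs
  proof -
    have "set xs \<subseteq> E.span T"
    proof
      fix x assume "x \<in> set xs"
      with that(1) show "x \<in> E.span T" by (intro T(2) R_linear) auto
    qed
    moreover have xs: "E.independent (set xs)" "distinct xs" using indep[OF that(2)] by simp_all
    ultimately have "card (set xs) \<le> card T"
      using E.independent_span_bound[OF T(1)] by simp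
    then show ?thesis using distinct_card[OF xs(2)] by simp
  qed
  then show ?thesis by blast
qed

lemma simple_subring_R: "simple_subring R K"
proof (rule simple_subring.intro)
  obtain w :: 'b where "w \<noteq> 0" using nontrivial by blast
  then have "app 1 w \<noteq> app 0 w" by simp
  then show "(1::'b endo) \<noteq> 0" by metis
  show "\<exists>ps. set ps \<subseteq> R \<times> R \<and> sandwich ps b = 1" if "b \<in> R" "b \<noteq> 0" for b
    using that by (rule simple_R)
  show "1 \<in> R" by (rule R_one)
  show "x + y \<in> R" if "x \<in> R" "y \<in> R" for x y using that by (rule R_add)
  show "x * y \<in> R" if "x \<in> R" "y \<in> R" for x y using that by (rule R_mult)
  show "- x \<in> R" if "x \<in> R" for x using that by (rule R_uminus)
  show "K = {k \<in> R. \<forall>r\<in>R. k * r = r * k}" by (rule K_def)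
  show "\<exists>N. \<forall>xs. set xs \<subseteq> R \<longrightarrow> kindep K xs \<longrightarrow> length xs \<le> N" by (rule bounded_indep_R)
qed

end


section \<open>Weak central polynomials\<close>

lemma (in irreducible_algebra) exists_weak_central_polynomial:
  assumes V: "V \<subseteq> A" "(\<lambda>w. 0) \<in> V" "V \<noteq> {\<lambda>w. 0}"
    and generated: "\<And>Q. End_subalgebra scale Q \<Longrightarrow> V \<subseteq> Q \<Longrightarrow> A \<subseteq> Q"
  shows "\<exists>c. weak_central_polynomial scale A V c"
proof -
  interpret E: vector_space "\<lambda>a f. scal a * f" by (rule vector_space_endo)
  define V' where "V' = {f. app f \<in> V}"
  have V'_R: "V' \<subseteq> R" using V(1) by (auto simp: V'_def R_def)
  have app_Endo: "app (Endo f) = f" if "f \<in> V" for f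
  proof -
    have "f \<in> A" using that V(1) by blast
    then obtain g where "f = app g" by (rule R_cases)
    then show ?thesis by (simp add: app_inverse)
  qed
  \<comment> \<open>A basis of the span of \<open>V'\<close>, finite because the linear
    endomorphisms are finitely spanned.\<close>
  obtain T where T: "T \<subseteq> V'" "E.independent T" "V' \<subseteq> E.span T"
    by (rule E.maximal_independent_subset[of V'])
  obtain S where S: "finite S" "\<And>f. linear_endo f \<Longrightarrow> f \<in> E.span S"
    by (rule linear_endo_finite_span) blast
  have "T \<subseteq> E.span S"
  proof
    fix t assume "t \<in> T"
    then have "t \<in> R" using T(1) V'_R by auto
    then show "t \<in> E.span S" by (intro S(2) R_linear)
  qed
  then have "finite T" using E.independent_span_bound[OF S(1) T(2)] by simp
  have "T \<noteq> {}"
  proof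
    assume "T = {}"
    have "f = (\<lambda>w. 0)" if f: "f \<in> V" for f
    proof -
      have "Endo f \<in> V'" using f app_Endo by (simp add: V'_def)
      with T(3) have "Endo f = 0" by (auto simp: \<open>T = {}\<close>)
      then have "app (Endo f) w = app 0 w" for w by simp
      with app_Endo[OF f] show ?thesis by auto
    qed
    then have "V \<subseteq> {\<lambda>w. 0}" by (intro subsetI) simp
    with V(2) have "V = {\<lambda>w. 0}" by (intro subset_antisym) simp_all
    with V(3) show False by (rule notE)
  qed
  \<comment> \<open>Enumerates \<open>T\<close>; indices left over also receive values in
    \<open>T\<close>, so \<open>v0\<close> is an admissible substitution in all variables.\<close>
  define v0 where "v0 = from_nat_into T"
  have range_v0: "range v0 = T"
    unfolding v0_def using \<open>T \<noteq> {}\<close> \<open>finite T\<close> by (intro range_from_nat_into countable_finite)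
  have lin: "linear_endo (v i)" if "range v \<subseteq> V'" for v :: "nat \<Rightarrow> 'b endo" and i
  proof -
    have "v i \<in> R" using that V'_R by blast
    then show ?thesis by (rule R_linear)
  qed
  have v0_V': "range v0 \<subseteq> V'" using range_v0 T(1) by simp
  define h0 where "h0 = (poly_value v0 :: 'a nc_poly \<Rightarrow> _)"
  have hom_h0: "ring_hom h0" unfolding h0_def by (rule ring_hom_poly_value) (rule lin[OF v0_V'])
  interpret h0: ring_hom h0 by fact
  have range_sub: "range (poly_value v) \<subseteq> R" if "range v \<subseteq> V'" for v
  proof -
    have "range v \<subseteq> R" using that V'_R by (rule subset_trans)
    then show ?thesis by (auto intro: R_poly_value)
  qed
  have h0_scal: "scal a * h0 p = h0 (Poly_Mapping.single 0 a * p)" for a p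
  proof -
    have "h0 (Poly_Mapping.single 0 a) = scal a"
      by (simp add: h0_def poly_value_single word_value_def zero_nc_word_def)
    then show ?thesis by (simp add: h0.hom_mult)
  qed
  have h0_R: "range h0 = R"
  proof
    show sub: "range h0 \<subseteq> R" unfolding h0_def by (rule range_sub[OF v0_V'])
    \<comment> \<open>The values of polynomials at \<open>v0\<close> form a subalgebra. It contains
      \<open>V\<close> because \<open>T\<close> spans \<open>V'\<close>, hence it contains all of
      \<open>A\<close>.\<close>
    define Q where "Q = app ` range h0"
    have Q: "app (h0 p) \<in> Q" for p by (simp add: Q_def)
    have "End_subalgebra scale Q"
      unfolding End_subalgebra_def
    proof (intro conjI ballI allI)
      show "Vector_Spaces.linear scale scale f" if "f \<in> Q" for f
        using that sub R_linear by (auto simp: Q_def linear_endo_iff)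
      show "id \<in> Q" using Q[of 1] by (simp add: h0.hom_one one_endo.rep_eq id_def)
      fix f assume "f \<in> Q"
      then obtain p where p: "f = app (h0 p)" by (auto simp: Q_def)
      show "(\<lambda>w. scale a (f w)) \<in> Q" for a
        using Q[of "Poly_Mapping.single 0 a * p"]
        by (simp add: p times_endo.rep_eq app_scal flip: h0_scal)
      fix g assume "g \<in> Q"
      then obtain q where q: "g = app (h0 q)" by (auto simp: Q_def)
      show "(\<lambda>w. f w + g w) \<in> Q"
        using Q[of "p + q"] by (simp add: p q h0.hom_add plus_endo.rep_eq)
      show "f \<circ> g \<in> Q"
        using Q[of "p * q"] by (simp add: p q h0.hom_mult times_endo.rep_eq o_def)
    qed
    moreover have "V \<subseteq> Q"
    proof
      fix f assume f: "f \<in> V"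
      have "E.subspace (range h0)"
      proof (rule E.subspaceI)
        show "0 \<in> range h0" by (metis h0.hom_zero rangeI)
        show "x + y \<in> range h0" if "x \<in> range h0" "y \<in> range h0" for x y
          using that by (auto simp flip: h0.hom_add)
        show "scal a * x \<in> range h0" if "x \<in> range h0" for a x
          using that by (auto simp: h0_scal)
      qed
      moreover have "T \<subseteq> range h0"
      proof
        fix t assume "t \<in> T"
        then obtain i where "t = v0 i" using range_v0 by blast
        then have "t = h0 (Poly_Mapping.single (Word [i]) 1)"
          by (simp add: h0_def poly_value_variable)
        then show "t \<in> range h0" by simp
      qed
      ultimately have "E.span T \<subseteq> range h0" by (intro E.span_minimal)
      moreover have "Endo f \<in> V'" using f app_Endo by (simp add: V'_def)
      ultimately have "Endo f \<in> range h0" using T(3) by blast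
      then have "app (Endo f) \<in> Q" by (simp add: Q_def)
      with app_Endo[OF f] show "f \<in> Q" by simp
    qed
    ultimately have "A \<subseteq> Q" by (rule generated)
    show "R \<subseteq> range h0"
    proof
      fix r assume "r \<in> R"
      with \<open>A \<subseteq> Q\<close> have "app r \<in> Q" by (auto simp: R_def)
      then show "r \<in> range h0" by (auto simp: Q_def app_inject)
    qed
  qed
  interpret S: simple_subring R K by (rule simple_subring_R)
  obtain ps where central: "\<And>h x. ring_hom h \<Longrightarrow> range h \<subseteq> R \<Longrightarrow> h (sandwich ps x) \<in> K"
    and "\<exists>r\<in>R. sandwich (map2pairs h0 ps) r \<noteq> 0"
    by (rule S.central_expression[OF hom_h0 h0_R]) blast
  then obtain r where r: "r \<in> R" "sandwich (map2pairs h0 ps) r \<noteq> 0" by blast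

  text \<open>
    Writing \<open>r\<close> in terms of a variable with nonzero value makes the polynomial vanish at zero,
    so that it is not constant.
  \<close>

  define x0 :: "'a nc_poly" where "x0 = Poly_Mapping.single (Word [0]) 1"
  have x0: "poly_value v x0 = v 0" for v by (simp add: x0_def poly_value_variable)
  have "v0 0 \<in> T" using range_v0 by blast
  then have "v0 0 \<noteq> 0" "v0 0 \<in> R" using E.dependent_zero T(1,2) V'_R by auto
  then obtain qs where qs: "set qs \<subseteq> R \<times> R" "sandwich qs (v0 0) = 1"
    using simple_R by blast
  \<comment> \<open>Left multiplication by \<open>r\<close> turns the value 1 of \<open>qs\<close>
    at \<open>v0 0\<close> into \<open>r\<close>; the trailing 1 matches the form of
    \<open>sandwich_map_outer\<close>.\<close>
  define qs' where "qs' = map (\<lambda>(a, b). (r * a, b * 1)) qs"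
  have "set qs' \<subseteq> R \<times> R" using qs(1) r(1) R_mult by (auto simp: qs'_def)
  moreover have "R \<times> R = range (map_prod h0 h0)"
    using map_prod_surj_on[OF h0_R h0_R] by simp
  ultimately have "qs' \<in> lists (range (map_prod h0 h0))" by (simp add: lists_eq_set)
  then obtain Qs where Qs: "qs' = map2pairs h0 Qs" by (auto simp: lists_image)
  have "h0 (sandwich Qs x0) = sandwich qs' (v0 0)"
    unfolding h0.hom_sandwich Qs by (simp add: h0_def x0)
  also have "\<dots> = r"
    unfolding qs'_def sandwich_map_outer by (simp add: qs(2))
  finally have h0_Qs: "h0 (sandwich Qs x0) = r" .
  \<comment> \<open>At \<open>v0\<close> the inner expression takes the value \<open>r\<close>,
    where \<open>ps\<close> is nonzero. At zero \<open>x0\<close> vanishes, and so does every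
    operator applied to it.\<close>
  define c where "c = sandwich ps (sandwich Qs x0)"
  have c_K: "poly_value v c \<in> K" if "range v \<subseteq> V'" for v
    unfolding c_def using ring_hom_poly_value[OF lin[OF that]] range_sub[OF that] by (rule central)
  have c_v0: "poly_value v0 c \<noteq> 0"
    using r(2) h0_Qs h0.hom_sandwich[of ps "sandwich Qs x0"] by (simp add: c_def h0_def)
  have zero_V': "range (\<lambda>i. 0) \<subseteq> V'" using V(2) by (auto simp: V'_def zero_endo.rep_eq)
  interpret z: ring_hom "poly_value (\<lambda>i. 0)"
    by (rule ring_hom_poly_value) (rule lin[OF zero_V'])
  have c_zero: "poly_value (\<lambda>i. 0) c = 0"
    by (simp add: c_def z.hom_sandwich x0)

  have nc: "nc_eval scale c (app \<circ> v) = app (poly_value v c)" for v by (simp add: app_poly_value)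
  \<comment> \<open>Substitutions by functions in \<open>V\<close> correspond to substitutions by
    elements of \<open>V'\<close>, which transfers the results back to
    \<open>nc_eval\<close>.\<close>
  have rep: "range (Endo \<circ> v) \<subseteq> V' \<and> app \<circ> (Endo \<circ> v) = v"
    if "range v \<subseteq> V" for v :: "nat \<Rightarrow> 'b \<Rightarrow> 'b"
  proof -
    have "v i \<in> V" for i using that by auto
    then show ?thesis by (auto simp: V'_def app_Endo)
  qed
  have app_V: "range (app \<circ> v) \<subseteq> V" if "range v \<subseteq> V'" for v :: "nat \<Rightarrow> 'b endo"
    using that by (auto simp: V'_def)
  have center: "app k \<in> center A" if k: "k \<in> K" for k
  proof -
    have "app k \<circ> f = f \<circ> app k" if "f \<in> A" for f
    proof -
      obtain g where g: "g \<in> R" "f = app g" using \<open>f \<in> A\<close> by (rule R_cases)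
      then have "app (k * g) = app (g * k)" using k by (simp add: K_def)
      with g(2) show ?thesis by (simp add: times_endo.rep_eq o_def)
    qed
    moreover have "app k \<in> A" using k by (simp add: K_def R_def)
    ultimately show ?thesis by (simp add: center_def)
  qed
  have ne: "app (poly_value v0 c) \<noteq> (\<lambda>w. 0)"
    using c_v0 app_inject[of "poly_value v0 c" 0] by (simp only: zero_endo.rep_eq not_False_eq_True)
  have "weak_central_polynomial scale A V c"
    unfolding weak_central_polynomial_def
  proof (intro conjI allI impI)
    fix v :: "nat \<Rightarrow> 'b \<Rightarrow> 'b"
    assume "range v \<subseteq> V"
    note v = rep[OF this, THEN conjunct1] rep[OF this, THEN conjunct2]
    show "nc_eval scale c v \<in> center A"
      using center[OF c_K[OF v(1)]] nc[of "Endo \<circ> v"] unfolding v(2) by simp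
  next
    have "nc_eval scale c (app \<circ> v0) \<noteq> (\<lambda>w. 0)" unfolding nc by (rule ne)
    then show "\<not> identity_on scale V c"
      unfolding identity_on_def using app_V[OF v0_V'] by blast
  next
    have "nc_eval scale c (app \<circ> v0) \<noteq> nc_eval scale c (app \<circ> (\<lambda>i. 0))"
      unfolding nc c_zero using ne by (simp add: zero_endo.rep_eq)
    then show "nonconstant_on scale V c"
      unfolding nonconstant_on_def using app_V[OF v0_V'] app_V[OF zero_V'] by blast
  qed
  then show ?thesis by blast
qed

section \<open>The generated subalgebra and the theorem\<close>

lemma End_subalgebra_linear_maps:
  assumes "vector_space scale"
  shows "End_subalgebra scale {f. Vector_Spaces.linear scale scale f}"
proof -
  interpret vector_space scale by fact
  show ?thesis
    by (auto simp: End_subalgebra_def Vector_Spaces.linear_iff assms scale_right_distrib mult.commute)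
qed

text \<open>Closure passes to the intersection of all subalgebras containing \<open>V\<close>.
  Linearity of its members needs at least one such subalgebra, and the algebra of all linear maps
  provides it.\<close>

lemma End_subalgebra_generated:
  assumes "vector_space scale" "\<And>f. f \<in> V \<Longrightarrow> Vector_Spaces.linear scale scale f"
  shows "End_subalgebra scale (generated_subalgebra scale V)"
proof -
  have "V \<subseteq> {f. Vector_Spaces.linear scale scale f}" using assms(2) by blast
  then have linear: "generated_subalgebra scale V \<subseteq> {f. Vector_Spaces.linear scale scale f}"
    unfolding generated_subalgebra_def
    by (intro hull_minimal End_subalgebra_linear_maps assms(1))
  define P where "P Q \<longleftrightarrow> End_subalgebra scale Q \<and> V \<subseteq> Q" for Q
  have mem: "f \<in> generated_subalgebra scale V \<longleftrightarrow> (\<forall>Q. P Q \<longrightarrow> f \<in> Q)" for f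
    by (auto simp: generated_subalgebra_def hull_def P_def)
  have P: "id \<in> Q" "\<And>f g. f \<in> Q \<Longrightarrow> g \<in> Q \<Longrightarrow> (\<lambda>w. f w + g w) \<in> Q"
    "\<And>f a. f \<in> Q \<Longrightarrow> (\<lambda>w. scale a (f w)) \<in> Q" "\<And>f g. f \<in> Q \<Longrightarrow> g \<in> Q \<Longrightarrow> f \<circ> g \<in> Q"
    if "P Q" for Q
    using that by (simp_all add: P_def End_subalgebra_def)
  show ?thesis
    unfolding End_subalgebra_def
  proof (intro conjI ballI allI)
    show "Vector_Spaces.linear scale scale f" if "f \<in> generated_subalgebra scale V" for f
      using that linear by blast
  qed (simp_all add: mem P)
qed

theorem mainTheorem6:
  fixes scaleL :: "'f::field \<Rightarrow> 'l::ab_group_add \<Rightarrow> 'l"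
    and bracket :: "'l \<Rightarrow> 'l \<Rightarrow> 'l"
    and scaleW :: "'f \<Rightarrow> 'w::ab_group_add \<Rightarrow> 'w"
    and rho :: "'l \<Rightarrow> 'w \<Rightarrow> 'w"
    and B :: "'w set"
    and V R :: "('w \<Rightarrow> 'w) set"
  assumes "simple_lie_algebra scaleL bracket"
    and "finite_dimensional_vector_space scaleW B"
    and "irreducible_lie_representation scaleL bracket scaleW rho"
    and "range rho \<noteq> {\<lambda>w. 0}"
    and "V = range rho"
    and "R = generated_subalgebra scaleW V"
  shows "\<exists>c :: 'f nc_poly. weak_central_polynomial scaleW R V c"
proof -
  interpret W: finite_dimensional_vector_space scaleW B by fact
  interpret rep: irreducible_lie_representation scaleL bracket scaleW rho by fact
  have V_R: "V \<subseteq> R" unfolding assms(6) generated_subalgebra_def by (rule hull_subset)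
  interpret irreducible_algebra scaleW B R
  proof
    show "End_subalgebra scaleW R"
      unfolding assms(6)
      by (rule End_subalgebra_generated) (auto simp: assms(5) rep.rho_endo W.vector_space_axioms)
    show "\<exists>w::'w. w \<noteq> 0" by (rule rep.nonzero_space)
    show "U = {0} \<or> U = UNIV"
      if U: "W.subspace U" "\<And>f u. f \<in> R \<Longrightarrow> u \<in> U \<Longrightarrow> f u \<in> U" for U
    \<comment> \<open>A subspace invariant under \<open>R\<close> is invariant under the
      representation, because each \<open>rho x\<close> lies in \<open>R\<close>.\<close>
    proof (rule rep.invariant_trivial[OF U(1)])
      have "rho x \<in> R" for x using V_R unfolding assms(5) by auto
      then show "rho x u \<in> U" if "u \<in> U" for x u using that by (rule U(2))
    qed
  qed
  have zero: "rho 0 = (\<lambda>w. 0)"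
    using rep.rho_add[of 0 0] by (simp add: fun_eq_iff)
  show ?thesis
  proof (rule exists_weak_central_polynomial[OF V_R])
    show "(\<lambda>w. 0) \<in> V" using rangeI[of rho 0] unfolding zero assms(5) .
    show "V \<noteq> {\<lambda>w. 0}" unfolding assms(5) by (rule assms(4))
    show "R \<subseteq> Q" if "End_subalgebra scaleW Q" "V \<subseteq> Q" for Q
      unfolding assms(6) generated_subalgebra_def using that(2,1) by (rule hull_minimal)
  qed
qed

end
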